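(* Let $\theta>1/2$, and let $\mathsf{G}$ be an atomless probability measure on $[0,+\infty)$ satisfying $\int_0^{+\infty}\log(1+x^2)\,\mathsf{G}(\mathrm{d}x)<+\infty$. Let $\widetilde{\mathfrak{p}}_{\theta}$ be a Dirichlet process with parameter $\theta$ and base probability measure $\mathsf{G}$, and let $\mathfrak{V}=\int x^2\,\widetilde{\mathfrak{p}}_{\theta}(\mathrm{d}x)-\left(\int x\,\widetilde{\mathfrak{p}}_{\theta}(\mathrm{d}x)\right)^2$ be its random variance. Then, for any $t\ge0$, $$\mathbb{E}_{\theta}\left[\left(\frac{1}{1+t\mathfrak{V}}\right)^{\theta-1/2}\right]=\int_0^1\frac12\left\{\Psi_{+,0}\left(\sqrt{t\rho(1-\rho)},\,t(1-\rho)\right)+\Psi_{-,0}\left(\sqrt{t\rho(1-\rho)},\,t(1-\rho)\right)\right\}\mathrm{Beta}(\mathrm{d}\rho;1/2,\theta-1/2),$$ where $$\Psi_{\pm,0}(u,v):=\exp\left\{-\theta\int_0^{+\infty}\log(1\pm2ux+vx^2)\,\mathsf{G}(\mathrm{d}x)\right\}.$$ Moreover, if $\theta>3/2$, then for every $z>0$, $$\mathbb{E}_{\theta}\left[\frac{1}{z+\mathfrak{V}}\right]=\int_0^{+\infty}\frac{f_{\mathfrak{V}}(x)}{z+x}\,\mathrm{d}x=z^{\theta-1}\int_{\Delta_2}\left[\frac{\Phi_{+,0}(z;\xi,\eta)+\Phi_{-,0}(z;\xi,\eta)}{2}\right]\mathrm{Dir}(\mathrm{d}\xi\,\mathrm{d}\eta;1/2,1,\theta-3/2),$$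 where $f_{\mathfrak{V}}$ denotes the probability density function of $\mathfrak{V}$ and $$\Phi_{\pm,0}(z;\xi,\eta):=\exp\left\{-\theta\int_0^{+\infty}\log(z\pm2\sqrt{z\xi\eta}\,x+\eta x^2)\,\mathsf{G}(\mathrm{d}x)\right\}.$$
   Context: Dirichlet process: for $\theta>0$ and a probability measure $\mathsf{G}$ on $\mathbb{R}$, let $V_n\sim\mathrm{Beta}(1,\theta)$, $n\ge1$, be independent, put $\omega_1:=V_1$ and $\omega_n:=V_n\prod_{i=1}^{n-1}(1-V_i)$ for $n\ge2$, and let $\xi_1,\xi_2,\dots$ be i.i.d. with law $\mathsf{G}$, independent of $(V_n)_{n\ge1}$. Then $\widetilde{\mathfrak{p}}_{\theta}:=\sum_{n\ge1}\omega_n\delta_{\xi_n}$. $\mathbb{E}_{\theta}$ denotes expectation with respect to the randomness of $\widetilde{\mathfrak{p}}_{\theta}$. $\mathrm{Beta}(\mathrm{d}\rho;a,b)$ is the beta probability distribution on $(0,1)$, with density $\frac{\Gamma(a+b)}{\Gamma(a)\Gamma(b)}\rho^{a-1}(1-\rho)^{b-1}$. $\Delta_2:=\{(\xi,\eta):\xi,\eta\ge0,\ \xi+\eta\le1\}$, and $\mathrm{Dir}(\mathrm{d}\xi\,\mathrm{d}\eta;a,b,c)$ is the Dirichlet probability distribution on $\Delta_2$, with density $\frac{\Gamma(a+b+c)}{\Gamma(a)\Gamma(b)\Gamma(c)}\xi^{a-1}\eta^{b-1}(1-\xi-\eta)^{c-1}$. *)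

theory Defs
  imports "HOL-Probability.Probability"
begin

definition beta_distribution :: "real \<Rightarrow> real \<Rightarrow> real measure" where
  "beta_distribution a b = density lborel (\<lambda>r. ennreal (indicator {0<..<1} r *
     (Gamma (a + b) / (Gamma a * Gamma b) * r powr (a - 1) * (1 - r) powr (b - 1))))"

definition Delta2 :: "(real \<times> real) set" where
  "Delta2 = {(x, y). 0 \<le> x \<and> 0 \<le> y \<and> x + y \<le> 1}"

definition dirichlet_distribution2 :: "real \<Rightarrow> real \<Rightarrow> real \<Rightarrow> (real \<times> real) measure" where
  "dirichlet_distribution2 a b c = density lborel (\<lambda>(x, y). ennreal (indicator Delta2 (x, y) *
     (Gamma (a + b + c) / (Gamma a * Gamma b * Gamma c) *
      x powr (a - 1) * y powr (b - 1) * (1 - x - y) powr (c - 1))))"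

text \<open>Indices start at 0 here, so \<open>stick_weight v n\<close> is the weight usually written
  \<open>\<omega>\<close> with index \<open>n + 1\<close>.\<close>

definition stick_weight :: "(nat \<Rightarrow> real) \<Rightarrow> nat \<Rightarrow> real" where
  "stick_weight v n = v n * (\<Prod>i<n. 1 - v i)"

text \<open>\<open>ennreal\<close> truncates negative weights to 0; these occur only on the null event that some
  stick proportion lies outside \<open>[0,1]\<close>.\<close>

definition weighted_diracs :: "(nat \<Rightarrow> real) \<Rightarrow> (nat \<Rightarrow> real) \<Rightarrow> real measure" where
  "weighted_diracs w x =
     measure_of UNIV (sets borel) (\<lambda>A. \<Sum>n. ennreal (w n) * emeasure (return borel (x n)) A)"

lemma sets_weighted_diracs [simp, measurable_cong]: "sets (weighted_diracs w x) = sets borel"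
  using sets.sigma_sets_eq[of "borel :: real measure"]
  by (simp add: weighted_diracs_def)

lemma space_weighted_diracs [simp]: "space (weighted_diracs w x) = UNIV"
  by (simp add: weighted_diracs_def)

lemma emeasure_weighted_diracs:
  assumes "A \<in> sets borel"
  shows "emeasure (weighted_diracs w x) A = (\<Sum>n. ennreal (w n) * indicator A (x n))"
proof -
  define D where "D = distr (density (count_space UNIV) (\<lambda>n. ennreal (w n))) borel x"
  have D: "emeasure D B = (\<Sum>n. ennreal (w n) * emeasure (return borel (x n)) B)"
    if "B \<in> sets borel" for B
  proof -
    have "emeasure D B = (\<integral>\<^sup>+n. ennreal (w n) * indicator (x -` B) n \<partial>count_space UNIV)"
      unfolding D_def using that by (simp add: emeasure_distr emeasure_density)
    also have "\<dots> = (\<Sum>n. ennreal (w n) * indicator (x -` B) n)"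
      by (rule nn_integral_count_space_nat)
    also have "\<dots> = (\<Sum>n. ennreal (w n) * emeasure (return borel (x n)) B)"
      using that by (simp add: indicator_def)
    finally show ?thesis .
  qed
  have sD: "sets D = sets borel" "space D = UNIV" by (simp_all add: D_def)
  have "weighted_diracs w x = measure_of (space D) (sets D) (emeasure D)"
    unfolding weighted_diracs_def sD
    by (rule measure_of_eq)
       (use D sets.sigma_sets_eq[of "borel :: real measure"] in auto)
  then have "weighted_diracs w x = D" by (simp add: measure_of_of_measure)
  then show ?thesis using D[OF assms] assms by simp
qed

definition dirichlet_process ::
    "'a measure \<Rightarrow> real \<Rightarrow> real measure \<Rightarrow> ('a \<Rightarrow> real measure) \<Rightarrow> bool" where
  "dirichlet_process M \<theta> G P \<longleftrightarrow> prob_space M \<and>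
     (\<exists>V \<xi>.
        prob_space.indep_vars M (\<lambda>_. borel) V (UNIV :: nat set) \<and>
        (\<forall>n. distr M borel (V n) = beta_distribution 1 \<theta>) \<and>
        prob_space.indep_vars M (\<lambda>_. borel) \<xi> (UNIV :: nat set) \<and>
        (\<forall>n. distr M borel (\<xi> n) = G) \<and>
        prob_space.indep_var M
          (Pi\<^sub>M UNIV (\<lambda>_. borel)) (\<lambda>\<omega> n. V n \<omega>)
          (Pi\<^sub>M UNIV (\<lambda>_. borel)) (\<lambda>\<omega> n. \<xi> n \<omega>) \<and>
        (\<forall>\<omega>\<in>space M. P \<omega> = weighted_diracs (stick_weight (\<lambda>n. V n \<omega>)) (\<lambda>n. \<xi> n \<omega>)))"

definition random_variance :: "real measure \<Rightarrow> real" where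
  "random_variance p = (LINT x|p. x\<^sup>2) - (LINT x|p. x)\<^sup>2"

text \<open>In the next two definitions \<open>s\<close> is the sign, \<open>1\<close> or \<open>-1\<close>.\<close>

definition Psi0 :: "real \<Rightarrow> real \<Rightarrow> real measure \<Rightarrow> real \<Rightarrow> real \<Rightarrow> real" where
  "Psi0 s \<theta> G u v = exp (- \<theta> * (LINT x:{0..}|G. ln (1 + s * (2 * u * x) + v * x\<^sup>2)))"

definition Phi0 :: "real \<Rightarrow> real \<Rightarrow> real measure \<Rightarrow> real \<Rightarrow> real \<Rightarrow> real \<Rightarrow> real" where
  "Phi0 s \<theta> G z \<xi> \<eta> =
     exp (- \<theta> * (LINT x:{0..}|G. ln (z + s * (2 * sqrt (z * \<xi> * \<eta>) * x) + \<eta> * x\<^sup>2)))"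

definition is_pdf :: "'a measure \<Rightarrow> ('a \<Rightarrow> real) \<Rightarrow> (real \<Rightarrow> real) \<Rightarrow> bool" where
  "is_pdf M X f \<longleftrightarrow> (\<forall>x. 0 \<le> f x) \<and> distributed M lborel X (\<lambda>x. ennreal (f x))"

end

theory Submission
  imports Defs "HOL-Real_Asymp.Real_Asymp"
begin

text \<open>
  Splitting the first stick off \<open>Y = \<integral>f dp\<close> gives \<open>Y = V f(\<xi>) + (1 - V) Y'\<close>, which together with
  the integral of \<open>(V x + (1 - V) y) powr (- \<theta> - 1)\<close> against \<open>Beta(1, \<theta>)\<close> yields the
  Markov--Krein identity \<open>E Y powr (- \<theta>) = exp (- \<theta> * \<integral>ln f dG)\<close>. Applied to the quadratics
  \<open>f(x) = 1 \<plusminus> 2ux + vx\<^sup>2\<close> it turns \<open>\<Psi>\<close> into an expectation in the first two moments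
  \<open>m\<^sub>1, m\<^sub>2\<close> of the process; with \<open>\<rho> = s\<^sup>2 / (1 + s\<^sup>2)\<close> the average over
  \<open>Beta(1/2, \<theta> - 1/2)\<close> becomes a Cauchy-type integral over the real line, in which the shift of \<open>s\<close>
  by \<open>sqrt t * m\<^sub>1\<close> leaves only \<open>m\<^sub>2 - m\<^sub>1\<^sup>2\<close>. Averaging the first formula over
  \<open>t = r / z\<close> with \<open>r \<sim> Beta(1, \<theta> - 3/2)\<close> gives the second one. Finally, given all other
  variables, the variance is a quadratic polynomial in the first stick with leading coefficient
  \<open>- (\<xi> - m\<^sub>1)\<^sup>2\<close>, which is almost surely nonzero because \<open>G\<close> is atomless; hence its law is
  absolutely continuous.
\<close>

subsection \<open>Substitution and Beta integrals\<close>

text \<open>Only a logarithmic moment of \<open>G\<close> is assumed, so no moment of the atoms need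
  exist and the sums behind the two moments of the process might diverge. The identities are
  therefore carried by nonnegative integrals and \<open>ennreal\<close>-valued sums, and finiteness
  of the second moment is itself extracted from a Markov--Krein identity that admits infinite sums.
  The exponents are dictated by two integrals. A power - (\<theta> + 1) of a mixture integrates
  against Beta(1, \<theta>) to a product of separate functions of its two end points, which
  decouples the first stick from the rest. On the line, the power - \<theta> of (s + \<alpha>)^2 + c
  integrates to a multiple of c^(1/2 - \<theta>), the origin of the exponent \<theta> - 1/2 in the
  first formula. The mixture integral, used once more with \<theta> - 3/2 in place of \<theta>,
  turns that power of 1 + r V / z into z / (z + V); hence the parameter of the second averaging and
  the condition \<theta> > 3/2.\<close>

lemma nn_integral_change_of_variables_1:
  fixes f g g' :: "real \<Rightarrow> real"
  assumes S: "S \<in> sets borel" and gS: "g ` S \<in> sets borel"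
    and der: "\<And>x. x \<in> S \<Longrightarrow> (g has_field_derivative g' x) (at x within S)"
    and inj: "inj_on g S"
    and [measurable]: "f \<in> borel_measurable borel" "g \<in> borel_measurable borel" "g' \<in> borel_measurable borel"
    and nonneg: "\<And>y. 0 \<le> f y"
  shows "(\<integral>\<^sup>+x\<in>S. ennreal (\<bar>g' x\<bar> * f (g x)) \<partial>lborel) = (\<integral>\<^sup>+y\<in>g ` S. ennreal (f y) \<partial>lborel)"
proof -
  note [measurable] = S gS
  \<comment> \<open>The change of variables theorem speaks of absolute integrability together with a
    real value \<open>b\<close>. By \<open>key\<close> this pair of facts says exactly that the
    nonnegative integral is \<open>ennreal b\<close>, so the two integrals take the same finite
    values and are infinite together.\<close>
  have key: "(h absolutely_integrable_on T \<and> integral T h = b) \<longleftrightarrow> (\<integral>\<^sup>+x\<in>T. ennreal (h x) \<partial>lborel) = ennreal b"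
    if [measurable]: "h \<in> borel_measurable borel" "T \<in> sets borel" and h: "\<And>x. 0 \<le> h x" and b: "0 \<le> b"
    for h :: "real \<Rightarrow> real" and T b
  proof -
    have eq: "(\<integral>\<^sup>+x\<in>T. ennreal (h x) \<partial>lborel) = (\<integral>\<^sup>+x. ennreal (indicator T x * h x) \<partial>lebesgue)"
      by (subst nn_integral_completion) (auto intro!: nn_integral_cong split: split_indicator)
    have meas: "(\<lambda>x. indicator T x * h x) \<in> borel_measurable lebesgue"
      by (intro measurable_completion) measurable
    show ?thesis
    proof
      assume "h absolutely_integrable_on T \<and> integral T h = b"
      then have "integrable lebesgue (\<lambda>x. indicator T x * h x)" "(LINT x|lebesgue. indicator T x * h x) = b"
        using set_lebesgue_integral_eq_integral(2)[of T h]
        by (auto simp: set_integrable_def set_lebesgue_integral_def)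
      then show "(\<integral>\<^sup>+x\<in>T. ennreal (h x) \<partial>lborel) = ennreal b"
        unfolding eq using h by (subst nn_integral_eq_integral) auto
    next
      assume "(\<integral>\<^sup>+x\<in>T. ennreal (h x) \<partial>lborel) = ennreal b"
      then have "has_bochner_integral lebesgue (\<lambda>x. indicator T x * h x) b"
        unfolding eq using meas h b by (intro has_bochner_integral_nn_integral) auto
      then have 1: "h absolutely_integrable_on T" and 2: "(LINT x|lebesgue. indicator T x * h x) = b"
        by (auto simp: set_integrable_def has_bochner_integral_iff)
      then show "h absolutely_integrable_on T \<and> integral T h = b"
        using set_lebesgue_integral_eq_integral(2)[OF 1] by (auto simp: set_lebesgue_integral_def)
    qed
  qed
  have "S \<in> sets lebesgue" using S by auto
  note cov = has_absolute_integral_change_of_variables_1'[OF this der inj, of f]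
  have *: "(\<integral>\<^sup>+x\<in>S. ennreal (\<bar>g' x\<bar> * f (g x)) \<partial>lborel) = ennreal b \<longleftrightarrow> (\<integral>\<^sup>+y\<in>g ` S. ennreal (f y) \<partial>lborel) = ennreal b"
    if "0 \<le> b" for b
    using cov[of b] key[of "\<lambda>x. \<bar>g' x\<bar> * f (g x)" S b] key[of f "g ` S" b] that nonneg by simp
  show ?thesis
  proof (cases "\<integral>\<^sup>+x\<in>S. ennreal (\<bar>g' x\<bar> * f (g x)) \<partial>lborel" rule: ennreal_cases)
    case (real b)
    then show ?thesis using *[of b] by simp
  next
    case top
    then show ?thesis using * by (cases "\<integral>\<^sup>+y\<in>g ` S. ennreal (f y) \<partial>lborel" rule: ennreal_cases) auto
  qed
qed

lemma sets_beta_distribution [simp, measurable_cong]: "sets (beta_distribution a b) = sets borel"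
  by (simp add: beta_distribution_def)

lemma space_beta_distribution [simp]: "space (beta_distribution a b) = UNIV"
  by (simp add: beta_distribution_def)

lemma nn_integral_beta_distribution:
  assumes [measurable]: "f \<in> borel_measurable borel"
  shows "(\<integral>\<^sup>+r. f r \<partial>beta_distribution a b) =
    (\<integral>\<^sup>+r\<in>{0<..<1}. ennreal (Gamma (a + b) / (Gamma a * Gamma b) * r powr (a - 1) * (1 - r) powr (b - 1)) * f r \<partial>lborel)"
  unfolding beta_distribution_def
  by (subst nn_integral_density) (auto intro!: nn_integral_cong split: split_indicator)

lemma AE_beta_distribution: "AE r in beta_distribution a b. 0 < r \<and> r < 1"
  unfolding beta_distribution_def
  by (subst AE_density) (auto split: split_indicator intro!: AE_I2)

lemma AE_beta_distributionI: "AE r in lborel. R r \<Longrightarrow> AE r in beta_distribution a b. R r"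
  unfolding beta_distribution_def by (subst AE_density) auto

lemma prob_space_beta_distribution:
  assumes "0 < a" "0 < b"
  shows "prob_space (beta_distribution a b)"
proof
  have "((\<lambda>t. t powr (a - 1) * (1 - t) powr (b - 1)) has_integral Beta a b) {0<..<1}"
    using has_integral_Beta_real[OF assms] by (simp add: has_integral_Icc_iff_Ioo)
  then have "((\<lambda>t. Gamma (a + b) / (Gamma a * Gamma b) * (t powr (a - 1) * (1 - t) powr (b - 1)))
      has_integral Gamma (a + b) / (Gamma a * Gamma b) * Beta a b) {0<..<1}"
    by (rule has_integral_mult_right)
  moreover have "Gamma (a + b) / (Gamma a * Gamma b) * Beta a b = 1"
    using Gamma_real_pos[OF assms(1)] Gamma_real_pos[OF assms(2)] Gamma_real_pos[OF add_pos_pos[OF assms]]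
    by (simp add: Beta_def)
  ultimately have "(\<integral>\<^sup>+t\<in>{0<..<1}. ennreal (Gamma (a + b) / (Gamma a * Gamma b) * (t powr (a - 1) * (1 - t) powr (b - 1))) \<partial>lborel) = ennreal 1"
    using Gamma_real_pos[OF assms(1)] Gamma_real_pos[OF assms(2)] Gamma_real_pos[OF add_pos_pos[OF assms]]
    by (intro nn_integral_has_integral_lebesgue') (simp_all only: mult_nonneg_nonneg divide_nonneg_pos powr_ge_zero mult_pos_pos less_imp_le)
  then have "(\<integral>\<^sup>+r. 1 \<partial>beta_distribution a b) = 1"
    by (subst nn_integral_beta_distribution) (auto simp: mult_ac)
  then show "emeasure (beta_distribution a b) (space (beta_distribution a b)) = 1"
    by simp
qed

lemma beta_distribution_1:
  assumes "0 < b"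
  shows "beta_distribution 1 b = density lborel (\<lambda>r. ennreal (indicator {0<..<1} r * (b * (1 - r) powr (b - 1))))"
proof -
  have "Gamma (1 + b) = b * Gamma b" using Gamma_plus1[of b] assms by (simp add: add.commute nonpos_Ints_def)
  moreover have "Gamma b > 0" using assms by (rule Gamma_real_pos)
  ultimately show ?thesis
    unfolding beta_distribution_def by (intro arg_cong2[where f=density]) (auto simp: fun_eq_iff split: split_indicator)
qed

text \<open>The exponent \<open>b + 1\<close> makes the integrand an exact derivative: (1 - v) / D v
  has derivative - x / (D v)^2, so its power \<open>b\<close>, up to the factor - 1 / x, is a
  primitive. That power runs from \<open>y powr (- b)\<close> at 0 to 0 at 1, which is why the
  result splits into a function of \<open>x\<close> times a function of \<open>y\<close>.\<close>

lemma nn_integral_beta_distribution_1_powr: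
  assumes b: "0 < b" and x: "0 < x" and y: "0 < y"
  shows "(\<integral>\<^sup>+v. ennreal ((v * x + (1 - v) * y) powr (- (b + 1))) \<partial>beta_distribution 1 b)
    = ennreal (inverse x * y powr (- b))"
proof -
  define D where "D v = v * x + (1 - v) * y" for v
  define F where "F v = - (((1 - v) / D v) powr b) / x" for v
  define f where "f v = b * (1 - v) powr (b - 1) * D v powr (- (b + 1))" for v
  have Dpos: "D v > 0" if "0 \<le> v" "v \<le> 1" for v
    using that x y by (cases "v = 0") (auto simp: D_def intro!: add_pos_nonneg)
  have contD: "isCont D v" for v unfolding D_def by (intro continuous_intros)
  have der: "(F has_real_derivative f v) (at v)" if v: "0 < v" "v < 1" for v
  proof -
    have D: "D v > 0" using Dpos v by auto
    have q: "((\<lambda>v. (1 - v) / D v) has_real_derivative (- x / (D v)\<^sup>2)) (at v)"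
    proof -
      have "(D has_real_derivative (x - y)) (at v)" unfolding D_def by (auto intro!: derivative_eq_intros)
      from DERIV_divide[OF _ this, of "\<lambda>v. 1 - v" "-1"]
      have "((\<lambda>v. (1 - v) / D v) has_real_derivative (- 1 * D v - (1 - v) * (x - y)) / (D v * D v)) (at v)"
        using D \<open>(D has_real_derivative _) _\<close> by (auto intro!: derivative_eq_intros)
      moreover have "- 1 * D v - (1 - v) * (x - y) = - x" by (simp add: D_def algebra_simps)
      ultimately show ?thesis by (simp add: power2_eq_square)
    qed
    have "((\<lambda>v. ((1 - v) / D v) powr b) has_real_derivative (b * ((1 - v) / D v) powr (b - 1) * (- x / (D v)\<^sup>2))) (at v)"
      using has_real_derivative_powr[of "(1 - v) / D v" b] D v
      by (intro DERIV_chain2[where f="\<lambda>u. u powr b", OF _ q]) auto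
    then have "(F has_real_derivative - (b * ((1 - v) / D v) powr (b - 1) * (- x / (D v)\<^sup>2)) / x) (at v)"
      unfolding F_def by (intro DERIV_cdivide DERIV_minus)
    moreover have "- (b * ((1 - v) / D v) powr (b - 1) * (- x / (D v)\<^sup>2)) / x = f v"
      using D v x by (simp add: f_def powr_divide powr_diff powr_minus powr_add field_simps power2_eq_square)
    ultimately show ?thesis by simp
  qed
  have "(F \<longlongrightarrow> F 0) (at_right 0)"
    unfolding F_def using Dpos[of 0] contD[of 0] x
    by (intro tendsto_intros tendsto_powr) (auto simp: isCont_def intro: tendsto_within_subset)
  moreover have "(F \<longlongrightarrow> F 1) (at_left 1)"
  proof -
    have "eventually (\<lambda>v. 0 < v \<and> v < 1) (at_left (1::real))"
      by (auto simp: eventually_at_left_field intro: exI[of _ 0])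
    then have "eventually (\<lambda>v. 0 \<le> (1 - v) / D v) (at_left 1)"
      by eventually_elim (auto intro!: divide_nonneg_pos Dpos)
    then show ?thesis
      unfolding F_def using Dpos[of 1] contD[of 1] x b
      by (intro tendsto_minus tendsto_divide tendsto_powr' tendsto_diff tendsto_const tendsto_ident_at)
        (auto simp: isCont_def intro: tendsto_within_subset)
  qed
  ultimately have "((F \<circ> real_of_ereal) \<longlongrightarrow> F 0) (at_right (ereal 0))" "((F \<circ> real_of_ereal) \<longlongrightarrow> F 1) (at_left (ereal 1))"
    by (simp_all only: ereal_tendsto_simps1)
  note lims = this
  have c: "isCont f v" if "0 < v" "v < 1" for v
    unfolding f_def using Dpos[of v] that
    by (intro continuous_intros contD) auto
  have nn: "AE v in lborel. ereal 0 < ereal v \<longrightarrow> ereal v < ereal 1 \<longrightarrow> 0 \<le> f v"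
    using b by (auto simp: f_def)
  \<comment> \<open>For \<open>b < 1\<close> the integrand blows up at 1. On the open interval the
    nonnegativity of \<open>f\<close> yields integrability, and only the one-sided limits of
    \<open>F\<close> enter.\<close>
  have int: "set_integrable lborel (einterval (ereal 0) (ereal 1)) f" "(LBINT v=ereal 0..ereal 1. f v) = F 1 - F 0"
    by (rule interval_integral_FTC_nonneg[OF _ der c nn lims]; simp)+
  then have "set_integrable lborel {0<..<1} f" "(LBINT v:{0<..<1}. f v) = F 1 - F 0"
    by (auto simp: interval_lebesgue_integral_def einterval_eq)
  then have "(\<integral>\<^sup>+v\<in>{0<..<1}. ennreal (f v) \<partial>lborel) = ennreal (F 1 - F 0)"
  proof -
    have "(\<integral>\<^sup>+v\<in>{0<..<1}. ennreal (f v) \<partial>lborel) = (\<integral>\<^sup>+v. ennreal (indicator {0<..<1} v * f v) \<partial>lborel)"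
      by (intro nn_integral_cong) (auto split: split_indicator)
    also have "\<dots> = ennreal (LBINT v:{0<..<1}. f v)"
      using \<open>set_integrable lborel {0<..<1} f\<close> b
      by (subst nn_integral_eq_integral) (auto simp: set_integrable_def set_lebesgue_integral_def f_def)
    finally show ?thesis using \<open>(LBINT v:{0<..<1}. f v) = F 1 - F 0\<close> by simp
  qed
  moreover have "F 1 - F 0 = inverse x * y powr (- b)"
    using y by (simp add: F_def D_def powr_divide powr_minus field_simps)
  moreover have "(\<integral>\<^sup>+v. ennreal (D v powr (- (b + 1))) \<partial>beta_distribution 1 b) = (\<integral>\<^sup>+v\<in>{0<..<1}. ennreal (f v) \<partial>lborel)"
    unfolding beta_distribution_1[OF b] D_def f_def using b
    by (subst nn_integral_density) (auto intro!: nn_integral_cong simp: ennreal_mult[symmetric] mult_ac split: split_indicator)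
  ultimately show ?thesis by (simp add: D_def)
qed

text \<open>Here \<open>a\<close> and \<open>b\<close> stand for the first two moments of the
  process, so that \<open>b - a^2\<close> is the variance. After the substitution each sign covers
  one half of the real line. This is why the signs are averaged: only an integral over the whole
  line is invariant under the shift that removes \<open>a\<close>.\<close>

lemma nn_integral_beta_distribution_quadratic:
  assumes \<theta>: "1 / 2 < \<theta>" and t: "0 \<le> t" and d: "a\<^sup>2 \<le> b"
  shows "(\<integral>\<^sup>+\<rho>. ennreal (1 / 2 * ((1 + 2 * sqrt (t * \<rho> * (1 - \<rho>)) * a + t * (1 - \<rho>) * b) powr (- \<theta>) +
      (1 - 2 * sqrt (t * \<rho> * (1 - \<rho>)) * a + t * (1 - \<rho>) * b) powr (- \<theta>))) \<partial>beta_distribution (1 / 2) (\<theta> - 1 / 2))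
    = ennreal ((1 + t * (b - a\<^sup>2)) powr (- (\<theta> - 1 / 2)))"
proof -
  define C where "C = Gamma \<theta> / (Gamma (1 / 2) * Gamma (\<theta> - 1 / 2))"
  define J where "J \<alpha> c = (\<integral>\<^sup>+s. ennreal (((s + \<alpha>)\<^sup>2 + c) powr (- \<theta>)) \<partial>lborel)" for \<alpha> c
  define L where "L t a b = (\<integral>\<^sup>+\<rho>. ennreal (1 / 2 * ((1 + 2 * sqrt (t * \<rho> * (1 - \<rho>)) * a + t * (1 - \<rho>) * b) powr (- \<theta>) +
      (1 - 2 * sqrt (t * \<rho> * (1 - \<rho>)) * a + t * (1 - \<rho>) * b) powr (- \<theta>))) \<partial>beta_distribution (1 / 2) (\<theta> - 1 / 2))" for t a b
  have C: "0 < C" unfolding C_def using \<theta> by (intro divide_pos_pos mult_pos_pos Gamma_real_pos) auto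
  have LJ: "L t a b = C * J (sqrt t * a) (1 + t * (b - a\<^sup>2))" if t: "0 \<le> t" and d: "a\<^sup>2 \<le> b" for t a b
  proof -
    define q where "q \<rho> = 1 / 2 * ((1 + 2 * sqrt (t * \<rho> * (1 - \<rho>)) * a + t * (1 - \<rho>) * b) powr (- \<theta>) +
      (1 - 2 * sqrt (t * \<rho> * (1 - \<rho>)) * a + t * (1 - \<rho>) * b) powr (- \<theta>))" for \<rho>
    define f where "f \<rho> = C * \<rho> powr (1 / 2 - 1) * (1 - \<rho>) powr (\<theta> - 1 / 2 - 1) * q \<rho>" for \<rho>
    define g where "g s = s\<^sup>2 / (1 + s\<^sup>2)" for s :: real
    define g' where "g' s = 2 * s / (1 + s\<^sup>2)\<^sup>2" for s :: real
    define h where "h \<alpha> s = ((s + \<alpha>)\<^sup>2 + (1 + t * (b - a\<^sup>2))) powr (- \<theta>)" for \<alpha> s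
    let ?\<alpha> = "sqrt t * a"
    have [measurable]: "q \<in> borel_measurable borel" "f \<in> borel_measurable borel" "g \<in> borel_measurable borel"
      "g' \<in> borel_measurable borel" "h \<alpha> \<in> borel_measurable borel" for \<alpha>
      unfolding q_def f_def g_def g'_def h_def by measurable
    have W: "1 + s\<^sup>2 > 0" for s :: real by (simp add: add_pos_nonneg)
    have f_nonneg: "0 \<le> f \<rho>" for \<rho> using C by (auto simp: f_def q_def)
    have image: "g ` {0<..} = {0<..<1}"
    proof (intro equalityI subsetI)
      fix \<rho> :: real assume \<rho>: "\<rho> \<in> {0<..<1}"
      then have "\<rho> = g (sqrt (\<rho> / (1 - \<rho>)))" by (simp add: g_def field_simps)
      then show "\<rho> \<in> g ` {0<..}" using \<rho> by (intro image_eqI[of _ _ "sqrt (\<rho> / (1 - \<rho>))"]) auto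
    qed (use W in \<open>auto simp: g_def field_simps\<close>)
    have inj: "inj_on g {0<..}"
    proof (rule inj_onI)
      fix x y :: real assume xy: "x \<in> {0<..}" "y \<in> {0<..}" "g x = g y"
      then have "x\<^sup>2 = y\<^sup>2" using W[of x] W[of y] by (simp add: g_def field_simps)
      then show "x = y" using xy by (simp add: power2_eq_iff)
    qed
    have der: "(g has_field_derivative g' s) (at s within S)" for s S
    proof -
      have "(g has_field_derivative (2 * s * (1 + s\<^sup>2) - s\<^sup>2 * (2 * s)) / ((1 + s\<^sup>2) * (1 + s\<^sup>2))) (at s within S)"
        unfolding g_def using W[of s] by (auto intro!: derivative_eq_intros)
      moreover have "(2 * s * (1 + s\<^sup>2) - s\<^sup>2 * (2 * s)) / ((1 + s\<^sup>2) * (1 + s\<^sup>2)) = g' s"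
        by (simp add: g'_def power2_eq_square algebra_simps)
      ultimately show ?thesis by simp
    qed
    have pw: "\<bar>g' s\<bar> * f (g s) = C * (h ?\<alpha> s + h (- ?\<alpha>) s)" if s: "0 < s" for s
    proof -
      define w where "w = 1 + s\<^sup>2"
      have w: "w > 0" and sw: "s\<^sup>2 = w - 1" using W[of s] by (auto simp: w_def)
      have g: "g s = s\<^sup>2 / w" and g1: "1 - g s = 1 / w" and g': "\<bar>g' s\<bar> = 2 * s / w\<^sup>2"
        using w s by (auto simp: g_def g'_def w_def field_simps)
      have "t * g s * (1 - g s) = t * (s / w)\<^sup>2" unfolding g1 by (simp add: g power2_eq_square)
      then have sq: "sqrt (t * g s * (1 - g s)) = sqrt t * s / w"
        using s w by (simp only: real_sqrt_mult real_sqrt_abs) simp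
      have quad: "(1 + \<epsilon> * (2 * sqrt (t * g s * (1 - g s)) * a) + t * (1 - g s) * b) powr (- \<theta>) = w powr \<theta> * h (\<epsilon> * ?\<alpha>) s"
        if \<epsilon>: "\<epsilon>\<^sup>2 = 1" for \<epsilon>
      proof -
        define Y where "Y = (s + \<epsilon> * ?\<alpha>)\<^sup>2 + (1 + t * (b - a\<^sup>2))"
        have Y: "Y > 0" unfolding Y_def using t d by (intro add_nonneg_pos add_pos_nonneg) auto
        have "(\<epsilon> * ?\<alpha>)\<^sup>2 = t * a\<^sup>2" using \<epsilon> t by (simp add: power_mult_distrib)
        then have "Y = w + 2 * s * (\<epsilon> * ?\<alpha>) + t * b"
          by (simp add: Y_def power2_sum w_def algebra_simps)
        then have "1 + \<epsilon> * (2 * sqrt (t * g s * (1 - g s)) * a) + t * (1 - g s) * b = Y / w"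
          unfolding sq unfolding g1 using w by (simp add: field_simps)
        moreover have "(Y / w) powr (- \<theta>) = w powr \<theta> * Y powr (- \<theta>)"
          using w Y by (simp add: powr_divide powr_minus field_simps)
        ultimately show ?thesis by (simp only: h_def Y_def)
      qed
      have "q (g s) = 1 / 2 * (w powr \<theta> * h ?\<alpha> s + w powr \<theta> * h (- ?\<alpha>) s)"
        using quad[of 1] quad[of "-1"] by (simp add: q_def)
      moreover have "g s powr (1 / 2 - 1) = w powr (1 / 2) / s"
      proof -
        have "s\<^sup>2 powr (1 / 2) = s" using s by (simp add: powr_half_sqrt)
        then show ?thesis using s w by (simp add: g powr_divide powr_minus field_simps)
      qed
      moreover have "(1 - g s) powr (\<theta> - 1 / 2 - 1) = w powr (3 / 2 - \<theta>)"
      proof -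
        have "w powr (3 / 2 - \<theta>) = inverse (w powr (\<theta> - 1 / 2 - 1))"
          by (simp add: powr_minus[symmetric])
        then show ?thesis using w unfolding g1 by (simp add: powr_divide inverse_eq_divide)
      qed
      \<comment> \<open>The Jacobian 2 s / w^2 meets w^(1/2) / s and w^(3/2 - \<theta>) from the two
        Beta factors and w^\<theta> from the quadratic; all powers of \<open>w\<close> and the
        factor \<open>s\<close> cancel.\<close>
      moreover have "w\<^sup>2 = w powr (1 / 2) * (w powr (3 / 2 - \<theta>) * w powr \<theta>)"
        using w by (simp add: powr_add[symmetric])
      ultimately have "\<bar>g' s\<bar> * f (g s) = 2 * s / (P * (R * T)) * (C * (P / s) * R * (1 / 2 * (T * h ?\<alpha> s + T * h (- ?\<alpha>) s)))"
        if "P = w powr (1 / 2)" "R = w powr (3 / 2 - \<theta>)" "T = w powr \<theta>" for P R T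
        unfolding f_def g' that by (simp only:)
      moreover have "2 * s / (P * (R * T)) * (C * (P / s) * R * (1 / 2 * (T * X + T * Y))) = C * (X + Y)"
        if "0 < P" "0 < R" "0 < T" for P R T X Y :: real
        using that s by (simp add: field_simps)
      ultimately show ?thesis using w by simp
    qed
    have "L t a b = (\<integral>\<^sup>+\<rho>. ennreal (q \<rho>) \<partial>beta_distribution (1 / 2) (\<theta> - 1 / 2))"
      unfolding L_def q_def ..
    also have "\<dots> = (\<integral>\<^sup>+\<rho>\<in>{0<..<1}. ennreal (f \<rho>) \<partial>lborel)"
    proof -
      have "ennreal (C * \<rho> powr (1 / 2 - 1) * (1 - \<rho>) powr (\<theta> - 1 / 2 - 1)) * ennreal (q \<rho>) = ennreal (f \<rho>)" for \<rho>
        unfolding f_def by (rule ennreal_mult[symmetric]) (use C in \<open>auto simp: q_def\<close>)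
      then show ?thesis
        by (subst nn_integral_beta_distribution) (auto intro!: nn_integral_cong simp: C_def split: split_indicator)
    qed
    also have "\<dots> = (\<integral>\<^sup>+\<rho>\<in>g ` {0<..}. ennreal (f \<rho>) \<partial>lborel)"
      unfolding image ..
    also have "\<dots> = (\<integral>\<^sup>+s\<in>{0<..}. ennreal (\<bar>g' s\<bar> * f (g s)) \<partial>lborel)"
      by (rule nn_integral_change_of_variables_1[symmetric]) (use der inj f_nonneg in \<open>auto simp: image\<close>)
    also have "\<dots> = (\<integral>\<^sup>+s. ennreal C * (ennreal (h ?\<alpha> s) * indicator {0<..} s + ennreal (h (- ?\<alpha>) s) * indicator {0<..} s) \<partial>lborel)"
      using C by (intro nn_integral_cong)
        (auto simp: pw ennreal_mult ennreal_plus[symmetric] h_def simp del: ennreal_plus split: split_indicator)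
    also have "\<dots> = ennreal C * ((\<integral>\<^sup>+s\<in>{0<..}. ennreal (h ?\<alpha> s) \<partial>lborel) + (\<integral>\<^sup>+s\<in>{0<..}. ennreal (h (- ?\<alpha>) s) \<partial>lborel))"
      by (simp add: nn_integral_cmult nn_integral_add)
    also have "(\<integral>\<^sup>+s\<in>{0<..}. ennreal (h (- ?\<alpha>) s) \<partial>lborel) = (\<integral>\<^sup>+s\<in>{..<0}. ennreal (h ?\<alpha> s) \<partial>lborel)"
    proof -
      have "(\<integral>\<^sup>+s\<in>{0<..}. ennreal (h (- ?\<alpha>) s) \<partial>lborel) = (\<integral>\<^sup>+s. ennreal (h (- ?\<alpha>) (- s)) * indicator {0<..} (- s) \<partial>lborel)"
        by (subst nn_integral_real_affine[where c="-1" and t=0]) auto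
      also have "\<dots> = (\<integral>\<^sup>+s\<in>{..<0}. ennreal (h ?\<alpha> s) \<partial>lborel)"
        by (intro nn_integral_cong) (auto simp: h_def power2_commute algebra_simps power2_eq_square split: split_indicator)
      finally show ?thesis .
    qed
    also have "(\<integral>\<^sup>+s\<in>{0<..}. ennreal (h ?\<alpha> s) \<partial>lborel) + \<dots> =
        (\<integral>\<^sup>+s. ennreal (h ?\<alpha> s) * indicator {0<..} s + ennreal (h ?\<alpha> s) * indicator {..<0} s \<partial>lborel)"
      by (simp add: nn_integral_add)
    also have "\<dots> = J ?\<alpha> (1 + t * (b - a\<^sup>2))"
      unfolding J_def h_def[symmetric]
      by (intro nn_integral_cong_AE eventually_mono[OF AE_lborel_singleton[of 0]])
        (auto split: split_indicator)
    finally show ?thesis .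
  qed
  have J: "J \<alpha> c = ennreal (c powr (1 / 2 - \<theta>)) * J 0 1" if c: "0 < c" for \<alpha> c
  proof -
    have "J \<alpha> c = ennreal (sqrt c) * (\<integral>\<^sup>+s. ennreal (((- \<alpha> + sqrt c * s + \<alpha>)\<^sup>2 + c) powr (- \<theta>)) \<partial>lborel)"
      unfolding J_def using c by (subst nn_integral_real_affine[where c="sqrt c" and t="- \<alpha>"]) auto
    also have "\<dots> = ennreal (sqrt c) * (\<integral>\<^sup>+s. ennreal (c powr (- \<theta>)) * ennreal (((s + 0)\<^sup>2 + 1) powr (- \<theta>)) \<partial>lborel)"
    proof -
      have "(- \<alpha> + sqrt c * s + \<alpha>)\<^sup>2 + c = c * ((s + 0)\<^sup>2 + 1)" for s
        using c by (simp add: power_mult_distrib algebra_simps)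
      then show ?thesis using c by (simp add: powr_mult ennreal_mult)
    qed
    also have "\<dots> = ennreal (sqrt c * c powr (- \<theta>)) * J 0 1"
      unfolding J_def using c by (subst nn_integral_cmult) (auto simp: ennreal_mult mult.assoc)
    also have "sqrt c * c powr (- \<theta>) = c powr (1 / 2 - \<theta>)"
      using c by (simp add: powr_half_sqrt[symmetric] powr_add[symmetric])
    finally show ?thesis .
  qed
  interpret beta: prob_space "beta_distribution (1 / 2) (\<theta> - 1 / 2)"
    using \<theta> by (intro prob_space_beta_distribution) auto
  \<comment> \<open>For \<open>t = a = b = 0\<close> the constant 1 is averaged over a probability
    measure. This fixes \<open>C * J 0 1\<close> without evaluating the line integral.\<close>
  have "1 = C * J 0 1"
    using LJ[of 0 0 0] beta.emeasure_space_1 by (simp add: L_def)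
  moreover have c: "0 < 1 + t * (b - a\<^sup>2)" using t d by (intro add_pos_nonneg) auto
  ultimately show ?thesis
    using LJ[OF t d] J[OF c] by (simp add: L_def mult.left_commute[of "ennreal C"])
qed

subsection \<open>Stick-breaking sums\<close>

text \<open>The integral of \<open>h\<close> against the stick-breaking measure, as a function of
  the sequences of sticks and atoms; see \<open>nn_integral_weighted_diracs\<close>. Values in
  \<open>ennreal\<close> give it a meaning before any finiteness is known.\<close>

definition stick_sum :: "(real \<Rightarrow> ennreal) \<Rightarrow> (nat \<Rightarrow> real) \<times> (nat \<Rightarrow> real) \<Rightarrow> ennreal" where
  "stick_sum h q = (\<Sum>n. ennreal (stick_weight (fst q) n) * h (snd q n))"

lemma measurable_stick_weight [measurable]:
  "(\<lambda>v. stick_weight v n) \<in> borel_measurable (Pi\<^sub>M UNIV (\<lambda>_. borel))"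
  unfolding stick_weight_def by measurable

lemma measurable_stick_sum [measurable]:
  assumes [measurable]: "h \<in> borel_measurable borel"
  shows "stick_sum h \<in> borel_measurable (Pi\<^sub>M UNIV (\<lambda>_. borel) \<Otimes>\<^sub>M Pi\<^sub>M UNIV (\<lambda>_. borel))"
  unfolding stick_sum_def by measurable

lemma stick_weight_case_nat:
  "stick_weight (case_nat a v) 0 = a"
  "stick_weight (case_nat a v) (Suc n) = (1 - a) * stick_weight v n"
  by (simp_all add: stick_weight_def prod.lessThan_Suc_shift del: prod.lessThan_Suc)

text \<open>Dropping the first stick and the first atom leaves a sum of the same kind, scaled by the
  remaining length \<open>1 - a\<close>. For random sequences this is the distributional fixed point
  equation of the Dirichlet process, here in pathwise form.\<close>

lemma stick_sum_case_nat:
  assumes "a \<le> 1"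
  shows "stick_sum h (case_nat a v, case_nat x y) = ennreal a * h x + ennreal (1 - a) * stick_sum h (v, y)"
proof -
  let ?f = "\<lambda>n. ennreal (stick_weight (case_nat a v) n) * h (case_nat x y n)"
  have "(\<lambda>n. ?f (Suc n)) sums (ennreal (1 - a) * stick_sum h (v, y))"
  proof -
    have "(\<lambda>n. ?f (Suc n)) = (\<lambda>n. ennreal (1 - a) * (ennreal (stick_weight v n) * h (y n)))"
      using assms by (simp add: stick_weight_case_nat ennreal_mult' mult.assoc)
    moreover have "(\<Sum>n. ennreal (1 - a) * (ennreal (stick_weight v n) * h (y n))) = ennreal (1 - a) * stick_sum h (v, y)"
      by (simp add: stick_sum_def)
    ultimately show ?thesis by (metis summableI summable_sums)
  qed
  from sums_Suc[OF this] show ?thesis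
    by (simp add: stick_sum_def stick_weight_case_nat sums_iff add.commute)
qed

lemma sum_stick_weight: "(\<Sum>n<N. stick_weight v n) = 1 - (\<Prod>i<N. 1 - v i)"
  by (induction N) (simp_all add: stick_weight_def algebra_simps)

lemma stick_weight_nonneg: "(\<And>n. 0 \<le> v n \<and> v n \<le> 1) \<Longrightarrow> 0 \<le> stick_weight v n"
  by (simp add: stick_weight_def prod_nonneg)

lemma stick_sum_mono: "(\<And>x. h x \<le> k x) \<Longrightarrow> stick_sum h q \<le> stick_sum k q"
  unfolding stick_sum_def by (intro suminf_le mult_left_mono) auto

lemma stick_sum_add: "stick_sum (\<lambda>x. h x + k x) q = stick_sum h q + stick_sum k q"
  unfolding stick_sum_def by (simp add: distrib_left suminf_add)

lemma stick_sum_cmult: "stick_sum (\<lambda>x. c * h x) q = c * stick_sum h q"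
  unfolding stick_sum_def by (simp add: mult.left_commute[of _ c])

text \<open>The defect from 1 is the limit of the products of the \<open>1 - fst q i\<close>. That
  it vanishes is only an almost sure statement; \<open>AE_stick_sum_1\<close> obtains it without
  studying these products.\<close>

lemma stick_sum_1_le:
  assumes "\<And>n. 0 \<le> fst q n \<and> fst q n \<le> 1"
  shows "stick_sum (\<lambda>_. 1) q \<le> 1"
proof -
  have "(\<Sum>n<N. ennreal (stick_weight (fst q) n)) \<le> 1" for N
  proof -
    have "(\<Sum>n<N. ennreal (stick_weight (fst q) n)) = ennreal (1 - (\<Prod>i<N. 1 - fst q i))"
      using stick_weight_nonneg[OF assms] by (simp add: sum_stick_weight[symmetric])
    also have "\<dots> \<le> ennreal 1"
      using assms by (intro ennreal_leI) (simp add: prod_nonneg)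
    finally show ?thesis by simp
  qed
  then show ?thesis
    unfolding stick_sum_def by (intro suminf_le_const) (auto intro: summableI)
qed

text \<open>The half line \<open>{a<..}\<close> is convex, so the mean value inequality bounds all
  difference quotients by \<open>C\<close>, an integrable majorant for a finite measure. Dominated
  convergence then applies along sequences. In the applications \<open>a = y / 2\<close> keeps away
  from the singularity at 0.\<close>

lemma has_real_derivative_integral:
  fixes g g' :: "real \<Rightarrow> 'a \<Rightarrow> real"
  assumes M: "finite_measure M" and z: "a < z"
    and der: "\<And>y \<omega>. a < y \<Longrightarrow> \<omega> \<in> space M \<Longrightarrow> ((\<lambda>y. g y \<omega>) has_real_derivative g' y \<omega>) (at y)"
    and bound: "\<And>y \<omega>. a < y \<Longrightarrow> \<omega> \<in> space M \<Longrightarrow> \<bar>g' y \<omega>\<bar> \<le> C"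
    and int: "\<And>y. a < y \<Longrightarrow> integrable M (g y)"
    and [measurable]: "g' z \<in> borel_measurable M"
  shows "((\<lambda>y. LINT \<omega>|M. g y \<omega>) has_real_derivative (LINT \<omega>|M. g' z \<omega>)) (at z)"
proof -
  interpret finite_measure M by fact
  have "((\<lambda>y. ((LINT \<omega>|M. g y \<omega>) - (LINT \<omega>|M. g z \<omega>)) / (y - z)) \<longlongrightarrow> (LINT \<omega>|M. g' z \<omega>)) (at z within {a<..})"
    unfolding tendsto_at_iff_sequentially
  proof (intro allI impI)
    fix X :: "nat \<Rightarrow> real"
    assume X: "\<forall>i. X i \<in> {a<..} - {z}" and lim: "X \<longlonglongrightarrow> z"
    note [measurable] = borel_measurable_integrable[OF int]
    have "(\<lambda>i. LINT \<omega>|M. (g (X i) \<omega> - g z \<omega>) / (X i - z)) \<longlonglongrightarrow> (LINT \<omega>|M. g' z \<omega>)"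
    proof (rule integral_dominated_convergence[where w="\<lambda>_. C"])
      show "AE \<omega> in M. (\<lambda>i. (g (X i) \<omega> - g z \<omega>) / (X i - z)) \<longlonglongrightarrow> g' z \<omega>"
      proof (rule AE_I2)
        fix \<omega> assume "\<omega> \<in> space M"
        then have "((\<lambda>y. (g y \<omega> - g z \<omega>) / (y - z)) \<longlongrightarrow> g' z \<omega>) (at z)"
          using der[OF z] by (simp add: has_field_derivative_iff)
        then show "(\<lambda>i. (g (X i) \<omega> - g z \<omega>) / (X i - z)) \<longlonglongrightarrow> g' z \<omega>"
          using X lim by (auto simp: tendsto_at_iff_sequentially comp_def)
      qed
      show "AE \<omega> in M. norm ((g (X i) \<omega> - g z \<omega>) / (X i - z)) \<le> C" for i
      proof (rule AE_I2)
        fix \<omega> assume \<omega>: "\<omega> \<in> space M"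
        have "norm (g (X i) \<omega> - g z \<omega>) \<le> C * norm (X i - z)"
        proof (rule field_differentiable_bound[of "{a<..}" _ "\<lambda>y. g' y \<omega>"])
          show "((\<lambda>y. g y \<omega>) has_real_derivative g' y \<omega>) (at y within {a<..})" if "y \<in> {a<..}" for y
            using that \<omega> by (auto intro: has_field_derivative_at_within[OF der])
          show "norm (g' y \<omega>) \<le> C" if "y \<in> {a<..}" for y
            using that \<omega> bound by simp
        qed (use X z in simp_all)
        then show "norm ((g (X i) \<omega> - g z \<omega>) / (X i - z)) \<le> C"
          using X by (simp add: norm_divide divide_le_eq)
      qed
    qed (use X z in auto)
    moreover have "(LINT \<omega>|M. (g (X i) \<omega> - g z \<omega>) / (X i - z)) = ((LINT \<omega>|M. g (X i) \<omega>) - (LINT \<omega>|M. g z \<omega>)) / (X i - z)" for i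
      using X z int by (subst Bochner_Integration.integral_divide_zero, subst Bochner_Integration.integral_diff) auto
    ultimately have "(\<lambda>i. ((LINT \<omega>|M. g (X i) \<omega>) - (LINT \<omega>|M. g z \<omega>)) / (X i - z)) \<longlonglongrightarrow> (LINT \<omega>|M. g' z \<omega>)"
      by (simp only:)
    then show "((\<lambda>y. ((LINT \<omega>|M. g y \<omega>) - (LINT \<omega>|M. g z \<omega>)) / (y - z)) \<circ> X) \<longlonglongrightarrow> (LINT \<omega>|M. g' z \<omega>)"
      by (simp add: comp_def)
  qed
  then show ?thesis
    using z by (simp add: has_field_derivative_iff at_within_open[of z "{a<..}"])
qed

section \<open>The product space of sticks and atoms\<close>

locale stick_breaking =
  fixes \<theta> :: real and G :: "real measure"
  assumes theta_pos: "0 < \<theta>" and prob_G: "prob_space G" and sets_G [simp, measurable_cong]: "sets G = sets borel"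
begin

abbreviation B :: "real measure" where "B \<equiv> beta_distribution 1 \<theta>"

text \<open>The joint law of all sticks and all atoms. Statements are proved on this space and
  carried over to an arbitrary Dirichlet process by
  \<open>dirichlet_process_obtain_sticks\<close>.\<close>

definition Q :: "((nat \<Rightarrow> real) \<times> (nat \<Rightarrow> real)) measure" where
  "Q = Pi\<^sub>M UNIV (\<lambda>_. B) \<Otimes>\<^sub>M Pi\<^sub>M UNIV (\<lambda>_. G)"

sublocale G: prob_space G by (rule prob_G)

sublocale B: prob_space B using theta_pos by (intro prob_space_beta_distribution) auto

sublocale SB: sequence_space B ..

sublocale SG: sequence_space G ..

lemma space_G [simp]: "space G = UNIV"
  using sets_eq_imp_space_eq[OF sets_G] by simp

lemma sets_Q [measurable_cong]: "sets Q = sets (Pi\<^sub>M UNIV (\<lambda>_. borel) \<Otimes>\<^sub>M Pi\<^sub>M UNIV (\<lambda>_. borel))"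
  unfolding Q_def by (intro sets_pair_measure_cong sets_PiM_cong) auto

lemma space_Q [simp]: "space Q = UNIV"
  using sets_eq_imp_space_eq[OF sets_Q] by (simp add: space_pair_measure space_PiM)

sublocale pair_prob_space "Pi\<^sub>M UNIV (\<lambda>_. B)" "Pi\<^sub>M UNIV (\<lambda>_. G)"
  by (intro pair_prob_space.intro pair_sigma_finite.intro prob_space_imp_sigma_finite prob_space_PiM B.prob_space_axioms G.prob_space_axioms)

sublocale Q: prob_space Q unfolding Q_def by (rule prob_space_axioms)

lemma prob_UNIV [simp]: "measure Q UNIV = 1" "measure G UNIV = 1"
  using Q.prob_space G.prob_space by simp_all

text \<open>An i.i.d. sequence has the law of a fresh first entry followed by an independent copy of
  the sequence; applied to sticks and to atoms, this splits off one of each. The stick is integrated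
  innermost because both applications compute with it while the atom and the remaining sequences are
  held fixed.\<close>

lemma nn_integral_Q_iterate:
  assumes F: "F \<in> borel_measurable Q"
  shows "(\<integral>\<^sup>+q. F q \<partial>Q) = (\<integral>\<^sup>+x. \<integral>\<^sup>+q. \<integral>\<^sup>+a. F (case_nat a (fst q), case_nat x (snd q)) \<partial>B \<partial>Q \<partial>G)"
proof -
  let ?SB = "Pi\<^sub>M UNIV (\<lambda>_. B)" and ?SG = "Pi\<^sub>M UNIV (\<lambda>_. G)"
  interpret SBG: pair_sigma_finite ?SB G ..
  interpret BG: pair_sigma_finite B G ..
  interpret BQ: pair_sigma_finite B Q ..
  have [measurable]: "F \<in> borel_measurable (?SB \<Otimes>\<^sub>M ?SG)" using F by (simp add: Q_def)
  have SB: "(\<integral>\<^sup>+v. f v \<partial>?SB) = (\<integral>\<^sup>+a. \<integral>\<^sup>+v. f (case_nat a v) \<partial>?SB \<partial>B)"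
    if [measurable]: "f \<in> borel_measurable ?SB" for f
    by (subst SB.PiM_iter[symmetric], subst nn_integral_distr)
      (simp_all add: split_beta', subst SB.P.nn_integral_fst[symmetric], simp_all)
  have SG: "(\<integral>\<^sup>+v. f v \<partial>?SG) = (\<integral>\<^sup>+a. \<integral>\<^sup>+v. f (case_nat a v) \<partial>?SG \<partial>G)"
    if [measurable]: "f \<in> borel_measurable ?SG" for f
    by (subst SG.PiM_iter[symmetric], subst nn_integral_distr)
      (simp_all add: split_beta', subst SG.P.nn_integral_fst[symmetric], simp_all)
  have "(\<integral>\<^sup>+q. F q \<partial>Q) = (\<integral>\<^sup>+v. \<integral>\<^sup>+y. F (v, y) \<partial>?SG \<partial>?SB)"
    unfolding Q_def by (subst SG.P.nn_integral_fst) simp_all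
  also have "\<dots> = (\<integral>\<^sup>+v. \<integral>\<^sup>+x. \<integral>\<^sup>+y. F (v, case_nat x y) \<partial>?SG \<partial>G \<partial>?SB)"
    by (intro nn_integral_cong SG) simp
  also have "\<dots> = (\<integral>\<^sup>+a. \<integral>\<^sup>+v. \<integral>\<^sup>+x. \<integral>\<^sup>+y. F (case_nat a v, case_nat x y) \<partial>?SG \<partial>G \<partial>?SB \<partial>B)"
    by (rule SB) simp
  also have "\<dots> = (\<integral>\<^sup>+a. \<integral>\<^sup>+x. \<integral>\<^sup>+v. \<integral>\<^sup>+y. F (case_nat a v, case_nat x y) \<partial>?SG \<partial>?SB \<partial>G \<partial>B)"
    by (intro nn_integral_cong SBG.Fubini'[symmetric]) simp
  also have "\<dots> = (\<integral>\<^sup>+a. \<integral>\<^sup>+x. \<integral>\<^sup>+q. F (case_nat a (fst q), case_nat x (snd q)) \<partial>Q \<partial>G \<partial>B)"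
    unfolding Q_def by (intro nn_integral_cong, subst SG.P.nn_integral_fst[symmetric]) simp_all
  also have "\<dots> = (\<integral>\<^sup>+x. \<integral>\<^sup>+a. \<integral>\<^sup>+q. F (case_nat a (fst q), case_nat x (snd q)) \<partial>Q \<partial>B \<partial>G)"
    unfolding Q_def by (rule BG.Fubini'[symmetric]) simp
  also have "\<dots> = (\<integral>\<^sup>+x. \<integral>\<^sup>+q. \<integral>\<^sup>+a. F (case_nat a (fst q), case_nat x (snd q)) \<partial>B \<partial>Q \<partial>G)"
    by (intro nn_integral_cong BQ.Fubini'[symmetric]) (simp add: Q_def)
  finally show ?thesis .
qed

lemma AE_Q_fst: "AE q in Q. \<forall>n. 0 < fst q n \<and> fst q n < 1"
proof -
  have "AE v in Pi\<^sub>M (UNIV :: nat set) (\<lambda>_. B). \<forall>n. 0 < v n \<and> v n < 1"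
    by (intro AE_all_countable[THEN iffD2] allI SB.AE_component AE_beta_distribution) auto
  then have "AE v in distr Q (Pi\<^sub>M UNIV (\<lambda>_. B)) fst. \<forall>n. 0 < v n \<and> v n < 1"
    unfolding Q_def SG.P.distr_pair_fst .
  then show ?thesis by (rule AE_distrD[rotated]) (simp add: Q_def)
qed

end

subsection \<open>The Markov--Krein identity\<close>

context stick_breaking
begin

lemma measurable_stick_sum_Q [measurable]:
  "h \<in> borel_measurable borel \<Longrightarrow> stick_sum h \<in> borel_measurable Q"
  using measurable_stick_sum[of h] by (simp add: measurable_cong_sets[OF sets_Q refl])

text \<open>Splitting off the first stick gives
  \<open>E (z + Y) powr (- \<theta> - 1) = E (1 / (z + f)) * E (z + Y) powr (- \<theta>)\<close>, so both sides of the
  identity have the same logarithmic derivative in \<open>z\<close>; both are asymptotic to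
  \<open>z powr (- \<theta>)\<close>.\<close>

lemma markov_krein_bounded:
  assumes f [measurable]: "f \<in> borel_measurable borel" and f_bounds: "\<And>x. 0 \<le> f x" "\<And>x. f x \<le> K" and z: "0 < z"
  shows "(\<integral>\<^sup>+q. ennreal ((z + enn2real (stick_sum (\<lambda>x. ennreal (f x)) q)) powr (- \<theta>)) \<partial>Q)
    = ennreal (exp (- \<theta> * (LINT x|G. ln (z + f x))))"
proof -
  define Y where "Y q = enn2real (stick_sum (\<lambda>x. ennreal (f x)) q)" for q
  have [measurable]: "Y \<in> borel_measurable Q" unfolding Y_def by measurable
  have K: "0 \<le> K" using f_bounds[of 0] by linarith
  have Y_nonneg: "0 \<le> Y q" for q by (simp add: Y_def)
  \<comment> \<open>\<open>enn2real\<close> would send an infinite sum to 0; a bounded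
    \<open>f\<close> and a total weight of at most 1 rule this out almost surely.\<close>
  have AE_Y: "AE q in Q. stick_sum (\<lambda>x. ennreal (f x)) q = ennreal (Y q) \<and> Y q \<le> K"
    using AE_Q_fst
  proof eventually_elim
    fix q :: "(nat \<Rightarrow> real) \<times> (nat \<Rightarrow> real)" assume q: "\<forall>n. 0 < fst q n \<and> fst q n < 1"
    have "stick_sum (\<lambda>x. ennreal (f x)) q \<le> stick_sum (\<lambda>x. ennreal K * 1) q"
      using f_bounds by (intro stick_sum_mono) (auto intro: ennreal_leI)
    also have "\<dots> = ennreal K * stick_sum (\<lambda>_. 1) q" by (rule stick_sum_cmult)
    also have "\<dots> \<le> ennreal K * 1"
      using q by (intro mult_left_mono stick_sum_1_le) (auto intro: less_imp_le)
    finally have le: "stick_sum (\<lambda>x. ennreal (f x)) q \<le> ennreal K" by simp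
    then have "stick_sum (\<lambda>x. ennreal (f x)) q < top"
      using ennreal_less_top[of K] by (rule order.strict_trans1)
    then have eq: "stick_sum (\<lambda>x. ennreal (f x)) q = ennreal (Y q)" by (simp add: Y_def)
    then show "stick_sum (\<lambda>x. ennreal (f x)) q = ennreal (Y q) \<and> Y q \<le> K"
      using le K by simp
  qed
  define F where "F y = (LINT q|Q. (y + Y q) powr (- \<theta>))" for y
  define F' where "F' y = (LINT q|Q. - \<theta> * (y + Y q) powr (- \<theta> - 1))" for y
  define R where "R y = (LINT x|G. inverse (y + f x))" for y
  define L where "L y = (LINT x|G. ln (y + f x))" for y
  have pw_le: "(y + Y q) powr (- p) \<le> y powr (- p)" if "0 < y" "0 \<le> p" for y p q
    using that Y_nonneg[of q] by (intro powr_mono2') auto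
  have intF: "integrable Q (\<lambda>q. (y + Y q) powr (- p))" if "0 < y" "0 \<le> p" for y p
    using pw_le[OF that] by (intro Q.integrable_const_bound[of _ "y powr (- p)"]) auto
  have intR: "integrable G (\<lambda>x. inverse (y + f x))" if "0 < y" for y
    using that f_bounds by (intro G.integrable_const_bound[of _ "inverse y"]) (auto intro!: le_imp_inverse_le simp: add_pos_nonneg)
  have ln_bounds: "ln y \<le> ln (y + f x)" "ln (y + f x) \<le> ln (y + K)" if "0 < y" for y x
    using that f_bounds[of x] by auto
  have intL: "integrable G (\<lambda>x. ln (y + f x))" if "0 < y" for y
  proof (rule G.integrable_const_bound[of _ "\<bar>ln y\<bar> + \<bar>ln (y + K)\<bar>"])
    show "AE x in G. norm (ln (y + f x)) \<le> \<bar>ln y\<bar> + \<bar>ln (y + K)\<bar>"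
    proof (rule AE_I2)
      fix x show "norm (ln (y + f x)) \<le> \<bar>ln y\<bar> + \<bar>ln (y + K)\<bar>"
        using ln_bounds[OF that, of x] unfolding real_norm_def by linarith
    qed
  qed simp
  have F_nn: "(\<integral>\<^sup>+q. ennreal ((y + Y q) powr (- p)) \<partial>Q) = ennreal (LINT q|Q. (y + Y q) powr (- p))" if "0 < y" "0 \<le> p" for y p
    using intF[OF that] by (intro nn_integral_eq_integral) auto
  have rec: "F' y = - \<theta> * R y * F y" if y: "0 < y" for y
  proof -
    have "ennreal (LINT q|Q. (y + Y q) powr (- (\<theta> + 1))) = (\<integral>\<^sup>+q. ennreal ((y + Y q) powr (- (\<theta> + 1))) \<partial>Q)"
      using theta_pos y by (subst F_nn) auto
    also have "\<dots> = (\<integral>\<^sup>+x. \<integral>\<^sup>+q. \<integral>\<^sup>+a. ennreal ((y + Y (case_nat a (fst q), case_nat x (snd q))) powr (- (\<theta> + 1))) \<partial>B \<partial>Q \<partial>G)"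
      by (rule nn_integral_Q_iterate) simp
    also have "\<dots> = (\<integral>\<^sup>+x. \<integral>\<^sup>+q. ennreal (inverse (y + f x)) * ennreal ((y + Y q) powr (- \<theta>)) \<partial>Q \<partial>G)"
    proof (rule nn_integral_cong, rule nn_integral_cong_AE)
      fix x
      show "AE q in Q. (\<integral>\<^sup>+a. ennreal ((y + Y (case_nat a (fst q), case_nat x (snd q))) powr (- (\<theta> + 1))) \<partial>B)
          = ennreal (inverse (y + f x)) * ennreal ((y + Y q) powr (- \<theta>))"
        using AE_Y
      proof eventually_elim
        fix q assume q: "stick_sum (\<lambda>x. ennreal (f x)) q = ennreal (Y q) \<and> Y q \<le> K"
        have "(\<integral>\<^sup>+a. ennreal ((y + Y (case_nat a (fst q), case_nat x (snd q))) powr (- (\<theta> + 1))) \<partial>B)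
            = (\<integral>\<^sup>+a. ennreal ((a * (y + f x) + (1 - a) * (y + Y q)) powr (- (\<theta> + 1))) \<partial>B)"
        proof (rule nn_integral_cong_AE, use AE_beta_distribution in eventually_elim)
          fix a :: real assume a: "0 < a \<and> a < 1"
          have "stick_sum (\<lambda>x. ennreal (f x)) (case_nat a (fst q), case_nat x (snd q)) = ennreal (a * f x + (1 - a) * Y q)"
            using a q f_bounds Y_nonneg[of q] by (subst stick_sum_case_nat) (auto simp: ennreal_mult ennreal_plus)
          then have "Y (case_nat a (fst q), case_nat x (snd q)) = a * f x + (1 - a) * Y q"
            using a f_bounds(1)[of x] Y_nonneg[of q]
            unfolding Y_def[of "(case_nat a (fst q), case_nat x (snd q))"] by (simp del: ennreal_plus)
          \<comment> \<open>As the weights \<open>a\<close> and \<open>1 - a\<close> add up to 1,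
            the shift \<open>y\<close> can be moved into both end points of the mixture, which is
            the form required by the Beta integral.\<close>
          then have "y + Y (case_nat a (fst q), case_nat x (snd q)) = a * (y + f x) + (1 - a) * (y + Y q)"
            by (simp add: algebra_simps)
          then show "ennreal ((y + Y (case_nat a (fst q), case_nat x (snd q))) powr (- (\<theta> + 1)))
              = ennreal ((a * (y + f x) + (1 - a) * (y + Y q)) powr (- (\<theta> + 1)))"
            by (simp only:)
        qed
        also have "\<dots> = ennreal (inverse (y + f x) * (y + Y q) powr (- \<theta>))"
          using y f_bounds[of x] Y_nonneg[of q] theta_pos by (intro nn_integral_beta_distribution_1_powr) auto
        finally show "(\<integral>\<^sup>+a. ennreal ((y + Y (case_nat a (fst q), case_nat x (snd q))) powr (- (\<theta> + 1))) \<partial>B)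
          = ennreal (inverse (y + f x)) * ennreal ((y + Y q) powr (- \<theta>))"
          using y f_bounds[of x] by (simp add: ennreal_mult)
      qed
    qed
    also have "\<dots> = (\<integral>\<^sup>+x. ennreal (inverse (y + f x)) \<partial>G) * (\<integral>\<^sup>+q. ennreal ((y + Y q) powr (- \<theta>)) \<partial>Q)"
      by (simp add: nn_integral_cmult nn_integral_multc)
    also have "(\<integral>\<^sup>+x. ennreal (inverse (y + f x)) \<partial>G) = ennreal (R y)"
      unfolding R_def using intR[OF y] y f_bounds by (intro nn_integral_eq_integral) (auto simp: add_nonneg_nonneg)
    also have "(\<integral>\<^sup>+q. ennreal ((y + Y q) powr (- \<theta>)) \<partial>Q) = ennreal (F y)"
      unfolding F_def using F_nn[OF y, of \<theta>] theta_pos by simp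
    finally have "ennreal (LINT q|Q. (y + Y q) powr (- (\<theta> + 1))) = ennreal (R y) * ennreal (F y)" .
    moreover have "0 \<le> R y" "0 \<le> F y"
      unfolding R_def F_def using y f_bounds by (auto intro!: Bochner_Integration.integral_nonneg simp: add_nonneg_nonneg)
    moreover have "0 \<le> (LINT q|Q. (y + Y q) powr (- (\<theta> + 1)))"
      by (intro Bochner_Integration.integral_nonneg) simp
    ultimately have "(LINT q|Q. (y + Y q) powr (- (\<theta> + 1))) = R y * F y"
      by (simp add: ennreal_mult[symmetric])
    then show ?thesis unfolding F'_def by simp
  qed
  have derF: "(F has_real_derivative F' y) (at y)" if y: "0 < y" for y
    unfolding F_def F'_def
  proof (rule has_real_derivative_integral[where a="y / 2" and C="\<theta> * (y / 2) powr (- \<theta> - 1)" and g'="\<lambda>y q. - \<theta> * (y + Y q) powr (- \<theta> - 1)"])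
    fix u q assume u: "y / 2 < u"
    then have pos: "0 < u + Y q" using y Y_nonneg[of q] by auto
    then show "((\<lambda>y. (y + Y q) powr (- \<theta>)) has_real_derivative - \<theta> * (u + Y q) powr (- \<theta> - 1)) (at u)"
      by (auto intro!: derivative_eq_intros)
    have "(u + Y q) powr (- (\<theta> + 1)) \<le> (y / 2) powr (- (\<theta> + 1))"
      using u y theta_pos Y_nonneg[of q] by (intro powr_mono2') auto
    then show "\<bar>- \<theta> * (u + Y q) powr (- \<theta> - 1)\<bar> \<le> \<theta> * (y / 2) powr (- \<theta> - 1)"
      using theta_pos by (simp add: abs_mult)
  qed (use y theta_pos in \<open>auto intro!: intF Q.finite_measure_axioms\<close>)
  have derL: "(L has_real_derivative R y) (at y)" if y: "0 < y" for y
    unfolding L_def R_def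
  proof (rule has_real_derivative_integral[where a="y / 2" and C="inverse (y / 2)" and g'="\<lambda>y x. inverse (y + f x)"])
    fix u x assume u: "y / 2 < u"
    then have pos: "0 < u + f x" using y f_bounds[of x] by auto
    then show "((\<lambda>y. ln (y + f x)) has_real_derivative inverse (u + f x)) (at u)"
      by (auto intro!: derivative_eq_intros simp: inverse_eq_divide)
    have "inverse (u + f x) \<le> inverse (y / 2)"
      using u y f_bounds[of x] by (intro le_imp_inverse_le) auto
    then show "\<bar>inverse (u + f x)\<bar> \<le> inverse (y / 2)" using pos by simp
  qed (use y in \<open>auto intro!: intL G.finite_measure_axioms\<close>)
  \<comment> \<open>\<open>H\<close> is the quotient of the two sides of the identity;
    \<open>rec\<close> makes its derivative vanish.\<close>
  define H where "H y = F y * exp (\<theta> * L y)" for y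
  have "\<exists>c. \<forall>y\<in>{0<..}. H y = c"
  proof (rule has_field_derivative_zero_constant)
    fix y :: real assume "y \<in> {0<..}"
    then have y: "0 < y" by simp
    have "(H has_real_derivative F' y * exp (\<theta> * L y) + F y * (exp (\<theta> * L y) * (\<theta> * R y))) (at y)"
      unfolding H_def using derF[OF y] derL[OF y] by (auto intro!: derivative_eq_intros)
    then show "(H has_real_derivative 0) (at y within {0<..})"
      using rec[OF y] by (auto intro: has_field_derivative_at_within simp: algebra_simps)
  qed simp
  then obtain c where c: "\<And>y. 0 < y \<Longrightarrow> H y = c" by auto
  \<comment> \<open>\<open>Y\<close> and \<open>f\<close> lie between 0 and \<open>K\<close>, so
    both factors of \<open>H\<close> can be estimated by powers of \<open>y\<close> and
    \<open>y + K\<close>. The two resulting bounds tend to 1 as \<open>y\<close> grows, and this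
    fixes the constant.\<close>
  have bounds: "(y / (y + K)) powr \<theta> \<le> c \<and> c \<le> ((y + K) / y) powr \<theta>" if y: "0 < y" for y
  proof -
    have "F y \<le> (LINT q|Q. y powr (- \<theta>))"
      unfolding F_def using y theta_pos intF[OF y, of \<theta>] pw_le by (intro integral_mono) auto
    then have F1: "F y \<le> y powr (- \<theta>)" by simp
    have "(LINT q|Q. (y + K) powr (- \<theta>)) \<le> F y"
      unfolding F_def
    proof (rule integral_mono_AE)
      show "AE q in Q. (y + K) powr - \<theta> \<le> (y + Y q) powr - \<theta>"
        using AE_Y by eventually_elim (use y theta_pos Y_nonneg in \<open>auto intro!: powr_mono2' add_pos_nonneg\<close>)
    qed (use y theta_pos intF[OF y, of \<theta>] in auto)
    then have F2: "(y + K) powr (- \<theta>) \<le> F y" by simp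
    have "0 \<le> F y" unfolding F_def by (intro Bochner_Integration.integral_nonneg) simp
    have L: "ln y \<le> L y" "L y \<le> ln (y + K)"
      unfolding L_def using ln_bounds[OF y] intL[OF y] by (auto intro!: G.integral_ge_const G.integral_le_const)
    have e: "exp (\<theta> * ln u) = u powr \<theta>" if "0 < u" for u using that by (simp add: powr_def)
    have "(y + K) powr (- \<theta>) * y powr \<theta> \<le> H y"
      unfolding H_def using \<open>0 \<le> F y\<close> F2 L(1) theta_pos y by (intro mult_mono) (auto simp: e[symmetric])
    moreover have "H y \<le> y powr (- \<theta>) * (y + K) powr \<theta>"
      unfolding H_def using F1 L(2) theta_pos y K by (intro mult_mono) (auto simp: e[symmetric])
    ultimately show ?thesis
      using y K c[OF y] by (simp add: powr_divide powr_minus field_simps)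
  qed
  have "c = 1"
  proof (rule antisym)
    have lim: "((\<lambda>y. y / (y + K)) \<longlongrightarrow> 1) at_top" "((\<lambda>y. (y + K) / y) \<longlongrightarrow> 1) at_top"
      by real_asymp+
    from tendsto_powr[OF lim(1) tendsto_const[of \<theta>]] show "1 \<le> c"
      by (intro tendsto_upperbound[of "\<lambda>y. (y / (y + K)) powr \<theta>"])
        (auto intro!: eventually_mono[OF eventually_gt_at_top[of 0]] simp: bounds)
    from tendsto_powr[OF lim(2) tendsto_const[of \<theta>]] show "c \<le> 1"
      by (intro tendsto_lowerbound[of "\<lambda>y. ((y + K) / y) powr \<theta>"])
        (auto intro!: eventually_mono[OF eventually_gt_at_top[of 0]] simp: bounds)
  qed
  then have "F z * exp (\<theta> * L z) = 1" using c[OF z] by (simp add: H_def)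
  then have "F z = exp (- \<theta> * L z)" by (simp add: exp_minus field_simps)
  then show ?thesis
    using F_nn[OF z, of \<theta>] theta_pos by (simp add: F_def L_def Y_def)
qed

text \<open>The value \<open>0\<close> at infinity is \<open>\<infinity> powr (- \<theta>)\<close>.\<close>

definition powr_at :: "real \<Rightarrow> ennreal \<Rightarrow> ennreal" where
  "powr_at z y = (if y = \<infinity> then 0 else ennreal ((z + enn2real y) powr (- \<theta>)))"

lemma measurable_powr_at [measurable]: "powr_at z \<in> borel_measurable borel"
  unfolding powr_at_def by measurable

lemma powr_at_le: "0 < z \<Longrightarrow> powr_at z y \<le> ennreal (z powr (- \<theta>))"
  using theta_pos by (auto simp: powr_at_def intro!: ennreal_leI powr_mono2')

text \<open>With all \<open>X n\<close> finite, only the limit can be infinite; there the negative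
  power tends to 0, the value chosen in \<open>powr_at\<close>.\<close>

lemma tendsto_powr_at:
  assumes z: "0 < z" and lim: "X \<longlonglongrightarrow> y" and fin: "\<And>n. X n \<noteq> \<infinity>"
  shows "(\<lambda>n. powr_at z (X n)) \<longlonglongrightarrow> powr_at z y"
proof (cases y rule: ennreal_cases)
  case (real r)
  then have "(\<lambda>n. enn2real (X n)) \<longlonglongrightarrow> r" using lim by (intro tendsto_enn2real) (simp only:)+
  then have "(\<lambda>n. ennreal ((z + enn2real (X n)) powr (- \<theta>))) \<longlonglongrightarrow> ennreal ((z + r) powr (- \<theta>))"
    using z real by (intro tendsto_ennrealI tendsto_powr tendsto_add tendsto_const) auto
  then show ?thesis using real fin by (simp add: powr_at_def)
next
  case top
  have "filterlim (\<lambda>n. enn2real (X n)) at_top sequentially"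
    unfolding filterlim_at_top
  proof
    fix Z :: real
    have "eventually (\<lambda>n. ennreal (max 0 Z) < X n) sequentially"
      using lim top by (intro order_tendstoD) auto
    then show "eventually (\<lambda>n. Z \<le> enn2real (X n)) sequentially"
    proof eventually_elim
      fix n assume "ennreal (max 0 Z) < X n"
      then have "ennreal (max 0 Z) < ennreal (enn2real (X n))"
        using fin[of n] by (simp add: ennreal_enn2real_if)
      then show "Z \<le> enn2real (X n)" by (subst (asm) ennreal_less_iff) auto
    qed
  qed
  then have "(\<lambda>n. (z + enn2real (X n)) powr (- \<theta>)) \<longlonglongrightarrow> 0"
    using theta_pos by (intro tendsto_neg_powr filterlim_tendsto_add_at_top[OF tendsto_const]) auto
  then have "(\<lambda>n. ennreal ((z + enn2real (X n)) powr (- \<theta>))) \<longlonglongrightarrow> ennreal 0"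
    by (intro tendsto_intros)
  then show ?thesis using top fin by (simp add: powr_at_def)
qed

text \<open>Truncation to \<open>min (h x) (real n)\<close> reduces this to the bounded case. The
  left sides converge because \<open>powr_at z\<close> is bounded by
  \<open>z powr (- \<theta>)\<close>, the right sides because the truncated logarithms stay between
  \<open>ln z\<close> and \<open>ln (z + h x)\<close>. The sum for \<open>h\<close> itself may be
  infinite here, so that its finiteness can be deduced afterwards.\<close>

lemma markov_krein_extended:
  assumes h [measurable]: "h \<in> borel_measurable borel" and h_nonneg: "\<And>x. 0 \<le> h x" and z: "0 < z"
    and int: "integrable G (\<lambda>x. ln (z + h x))"
  shows "(\<integral>\<^sup>+q. powr_at z (stick_sum (\<lambda>x. ennreal (h x)) q) \<partial>Q) = ennreal (exp (- \<theta> * (LINT x|G. ln (z + h x))))"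
proof -
  define f where "f n x = min (h x) (real n)" for n x
  have [measurable]: "f n \<in> borel_measurable borel" for n unfolding f_def by measurable
  have f_nonneg: "0 \<le> f n x" for n x using h_nonneg by (simp add: f_def)
  have f_lim: "(\<lambda>n. f n x) \<longlonglongrightarrow> h x" for x
  proof -
    obtain N where N: "h x \<le> real N" using real_arch_simple by blast
    have "eventually (\<lambda>n. f n x = h x) sequentially"
      using eventually_ge_at_top[of N] by eventually_elim (use N in \<open>auto simp: f_def\<close>)
    then show ?thesis by (rule tendsto_eventually)
  qed
  have fin: "stick_sum (\<lambda>x. ennreal (f n x)) q \<noteq> \<infinity>" if q: "\<forall>n. 0 < fst q n \<and> fst q n < 1" for n q
  proof -
    have "stick_sum (\<lambda>x. ennreal (f n x)) q \<le> stick_sum (\<lambda>x. ennreal n * 1) q"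
      by (intro stick_sum_mono) (auto simp: f_def ennreal_of_nat_eq_real_of_nat intro: ennreal_leI)
    also have "\<dots> = ennreal n * stick_sum (\<lambda>_. 1) q" by (rule stick_sum_cmult)
    also have "\<dots> \<le> ennreal n * 1"
      using q by (intro mult_left_mono stick_sum_1_le) (auto intro: less_imp_le)
    finally show ?thesis by (auto simp: top_unique)
  qed
  \<comment> \<open>The truncations increase with \<open>n\<close>, so the supremum can be exchanged
    with the series.\<close>
  have lim: "(\<lambda>n. stick_sum (\<lambda>x. ennreal (f n x)) q) \<longlonglongrightarrow> stick_sum (\<lambda>x. ennreal (h x)) q" for q
  proof -
    have inc: "incseq (\<lambda>n. ennreal (f n x))" for x
      by (auto simp: incseq_def f_def intro!: ennreal_leI)
    then have "ennreal (h x) = (SUP n. ennreal (f n x))" for x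
      using LIMSEQ_unique[OF LIMSEQ_SUP tendsto_ennrealI[OF f_lim]] by metis
    then have "stick_sum (\<lambda>x. ennreal (h x)) q = (\<Sum>i. SUP n. ennreal (stick_weight (fst q) i) * ennreal (f n (snd q i)))"
      by (simp add: stick_sum_def SUP_mult_left_ennreal)
    also have "\<dots> = (SUP n. stick_sum (\<lambda>x. ennreal (f n x)) q)"
      unfolding stick_sum_def using inc
      by (intro ennreal_suminf_SUP_eq) (auto simp: incseq_def intro!: mult_left_mono)
    finally have eq: "stick_sum (\<lambda>x. ennreal (h x)) q = (SUP n. stick_sum (\<lambda>x. ennreal (f n x)) q)" .
    show ?thesis
      unfolding eq by (intro LIMSEQ_SUP incseq_SucI stick_sum_mono) (auto simp: f_def intro!: ennreal_leI)
  qed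
  have "(\<lambda>n. \<integral>\<^sup>+q. powr_at z (stick_sum (\<lambda>x. ennreal (f n x)) q) \<partial>Q) \<longlonglongrightarrow> (\<integral>\<^sup>+q. powr_at z (stick_sum (\<lambda>x. ennreal (h x)) q) \<partial>Q)"
  proof (rule nn_integral_dominated_convergence[where w="\<lambda>_. ennreal (z powr (- \<theta>))"])
    show "AE q in Q. (\<lambda>n. powr_at z (stick_sum (\<lambda>x. ennreal (f n x)) q)) \<longlonglongrightarrow> powr_at z (stick_sum (\<lambda>x. ennreal (h x)) q)"
      using AE_Q_fst by eventually_elim (intro tendsto_powr_at z lim fin)
  qed (auto simp: powr_at_le[OF z] Q.emeasure_space_1[simplified])
  moreover have "(\<integral>\<^sup>+q. powr_at z (stick_sum (\<lambda>x. ennreal (f n x)) q) \<partial>Q) = ennreal (exp (- \<theta> * (LINT x|G. ln (z + f n x))))" for n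
  proof -
    have "(\<integral>\<^sup>+q. powr_at z (stick_sum (\<lambda>x. ennreal (f n x)) q) \<partial>Q) =
        (\<integral>\<^sup>+q. ennreal ((z + enn2real (stick_sum (\<lambda>x. ennreal (f n x)) q)) powr (- \<theta>)) \<partial>Q)"
    proof (rule nn_integral_cong_AE, use AE_Q_fst in eventually_elim)
      fix q :: "(nat \<Rightarrow> real) \<times> (nat \<Rightarrow> real)" assume "\<forall>n. 0 < fst q n \<and> fst q n < 1"
      from fin[OF this] show "powr_at z (stick_sum (\<lambda>x. ennreal (f n x)) q) = ennreal ((z + enn2real (stick_sum (\<lambda>x. ennreal (f n x)) q)) powr (- \<theta>))"
        by (simp add: powr_at_def)
    qed
    also have "\<dots> = ennreal (exp (- \<theta> * (LINT x|G. ln (z + f n x))))"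
      by (rule markov_krein_bounded[where K="real n"]) (use z f_nonneg in \<open>auto simp: f_def\<close>)
    finally show ?thesis .
  qed
  moreover have "(\<lambda>n. LINT x|G. ln (z + f n x)) \<longlonglongrightarrow> (LINT x|G. ln (z + h x))"
  proof (rule integral_dominated_convergence[where w="\<lambda>x. \<bar>ln z\<bar> + \<bar>ln (z + h x)\<bar>"])
    show "AE x in G. (\<lambda>n. ln (z + f n x)) \<longlonglongrightarrow> ln (z + h x)"
      using z h_nonneg by (intro AE_I2 tendsto_intros f_lim) (metis add_pos_nonneg less_irrefl)
    show "AE x in G. norm (ln (z + f n x)) \<le> \<bar>ln z\<bar> + \<bar>ln (z + h x)\<bar>" for n
    proof (rule AE_I2)
      fix x
      have "ln z \<le> ln (z + f n x)" "ln (z + f n x) \<le> ln (z + h x)"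
        using z f_nonneg[of n x] h_nonneg[of x] by (auto simp: f_def)
      then show "norm (ln (z + f n x)) \<le> \<bar>ln z\<bar> + \<bar>ln (z + h x)\<bar>"
        unfolding real_norm_def by linarith
    qed
  qed (use int in auto)
  then have "(\<lambda>n. ennreal (exp (- \<theta> * (LINT x|G. ln (z + f n x))))) \<longlonglongrightarrow> ennreal (exp (- \<theta> * (LINT x|G. ln (z + h x))))"
    by (intro tendsto_intros)
  ultimately show ?thesis by (simp add: LIMSEQ_unique)
qed

text \<open>Letting \<open>\<epsilon> \<rightarrow> 0\<close> in the identity for \<open>1 + \<epsilon> h\<close> isolates the event that the sum is finite.\<close>

lemma AE_stick_sum_finite:
  assumes h [measurable]: "h \<in> borel_measurable borel" and h_nonneg: "\<And>x. 0 \<le> h x"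
    and int: "integrable G (\<lambda>x. ln (1 + h x))"
  shows "AE q in Q. stick_sum (\<lambda>x. ennreal (h x)) q \<noteq> \<infinity>"
proof -
  let ?A = "{q. stick_sum (\<lambda>x. ennreal (h x)) q \<noteq> \<infinity>}"
  have [measurable]: "?A \<in> sets Q"
  proof -
    have "{q \<in> space Q. stick_sum (\<lambda>x. ennreal (h x)) q \<noteq> \<infinity>} \<in> sets Q" by measurable
    then show ?thesis by simp
  qed
  define e where "e n = inverse (real (Suc n))" for n
  have e: "0 < e n" "e n \<le> 1" for n by (auto simp: e_def field_simps)
  have e_lim: "e \<longlonglongrightarrow> 0" unfolding e_def by (rule LIMSEQ_inverse_real_of_nat)
  have bnd: "0 \<le> ln (1 + e n * h x)" "ln (1 + e n * h x) \<le> ln (1 + h x)" for n x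
    using e[of n] h_nonneg[of x] mult_left_le_one_le[of "h x" "e n"] by (auto simp: add_pos_nonneg)
  have inte: "integrable G (\<lambda>x. ln (1 + e n * h x))" for n
  proof (rule Bochner_Integration.integrable_bound[OF int])
    show "AE x in G. norm (ln (1 + e n * h x)) \<le> norm (ln (1 + h x))"
    proof (rule AE_I2)
      fix x show "norm (ln (1 + e n * h x)) \<le> norm (ln (1 + h x))"
        using bnd[of n x] unfolding real_norm_def by linarith
    qed
  qed simp
  \<comment> \<open>Outside \<open>?A\<close> scaling by \<open>e n > 0\<close> leaves the sum
    infinite, so \<open>powr_at 1\<close> is 0 there; elsewhere it is at most 1. Each left side is
    thus a lower bound for the probability of a finite sum, and these bounds tend to 1.\<close>
  have le: "ennreal (exp (- \<theta> * (LINT x|G. ln (1 + e n * h x)))) \<le> emeasure Q ?A" for n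
  proof -
    have "ennreal (exp (- \<theta> * (LINT x|G. ln (1 + e n * h x)))) = (\<integral>\<^sup>+q. powr_at 1 (stick_sum (\<lambda>x. ennreal (e n * h x)) q) \<partial>Q)"
      by (rule markov_krein_extended[symmetric]) (use e[of n] h_nonneg inte in auto)
    also have "\<dots> \<le> (\<integral>\<^sup>+q. indicator ?A q \<partial>Q)"
    proof (rule nn_integral_mono)
      fix q
      have "stick_sum (\<lambda>x. ennreal (e n * h x)) q = ennreal (e n) * stick_sum (\<lambda>x. ennreal (h x)) q"
        using e[of n] h_nonneg by (simp add: ennreal_mult stick_sum_cmult)
      then show "powr_at 1 (stick_sum (\<lambda>x. ennreal (e n * h x)) q) \<le> indicator ?A q"
        using powr_at_le[of 1 "stick_sum (\<lambda>x. ennreal (e n * h x)) q"] e[of n]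
        by (cases "q \<in> ?A") (auto simp: powr_at_def ennreal_mult_top)
    qed
    finally show ?thesis using nn_integral_indicator[OF \<open>?A \<in> sets Q\<close>] by simp
  qed
  have "(\<lambda>n. LINT x|G. ln (1 + e n * h x)) \<longlonglongrightarrow> (LINT x|G. ln (1 + 0 * h x))"
  proof (rule integral_dominated_convergence[where w="\<lambda>x. ln (1 + h x)"])
    show "AE x in G. (\<lambda>n. ln (1 + e n * h x)) \<longlonglongrightarrow> ln (1 + 0 * h x)"
      by (intro AE_I2 tendsto_intros e_lim) auto
  qed (use bnd int in auto)
  then have "(\<lambda>n. ennreal (exp (- \<theta> * (LINT x|G. ln (1 + e n * h x))))) \<longlonglongrightarrow> ennreal (exp (- \<theta> * 0))"
    by (intro tendsto_intros) simp
  then have "1 \<le> emeasure Q ?A"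
    using le by (intro LIMSEQ_le_const2) auto
  then have "emeasure Q ?A = 1" using Q.emeasure_le_1 by (intro antisym)
  then have "prob_space.prob Q ?A = 1" by (simp add: measure_def)
  then show ?thesis using Q.AE_prob_1[of ?A] by simp
qed

lemma markov_krein:
  assumes h [measurable]: "h \<in> borel_measurable borel" and h_nonneg: "\<And>x. 0 \<le> h x" and z: "0 < z"
    and int: "integrable G (\<lambda>x. ln (z + h x))"
    and fin: "AE q in Q. stick_sum (\<lambda>x. ennreal (h x)) q \<noteq> \<infinity>"
  shows "(\<integral>\<^sup>+q. ennreal ((z + enn2real (stick_sum (\<lambda>x. ennreal (h x)) q)) powr (- \<theta>)) \<partial>Q)
    = ennreal (exp (- \<theta> * (LINT x|G. ln (z + h x))))"
  unfolding markov_krein_extended[OF assms(1-4), symmetric]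
  by (rule nn_integral_cong_AE, use fin in eventually_elim) (simp add: powr_at_def)

text \<open>For \<open>f = 1\<close> and \<open>z = 1\<close> the identity gives E (1 + S)^(-
  \<theta>) = 2^(- \<theta>), where \<open>S\<close> is the total weight. Since \<open>S\<close> is
  at most 1, the integrand is nowhere below 2^(- \<theta>) up to a null set, so equality of the
  expectations forces \<open>S = 1\<close> almost surely.\<close>

lemma AE_stick_sum_1: "AE q in Q. stick_sum (\<lambda>_. 1) q = 1"
proof -
  define S where "S q = enn2real (stick_sum (\<lambda>_. ennreal 1) q)" for q
  have [measurable]: "S \<in> borel_measurable Q" unfolding S_def by measurable
  have le: "AE q in Q. stick_sum (\<lambda>_. 1) q = ennreal (S q) \<and> S q \<le> 1"
    using AE_Q_fst
  proof eventually_elim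
    fix q :: "(nat \<Rightarrow> real) \<times> (nat \<Rightarrow> real)" assume "\<forall>n. 0 < fst q n \<and> fst q n < 1"
    then have le: "stick_sum (\<lambda>_. 1) q \<le> 1" by (intro stick_sum_1_le) (auto intro: less_imp_le)
    then have "stick_sum (\<lambda>_. 1) q < top" by (rule order.strict_trans1) simp
    then show "stick_sum (\<lambda>_. 1) q = ennreal (S q) \<and> S q \<le> 1"
      using le by (cases "stick_sum (\<lambda>_. 1) q" rule: ennreal_cases) (auto simp: S_def)
  qed
  have "(\<integral>\<^sup>+q. ennreal ((1 + S q) powr (- \<theta>)) \<partial>Q) = ennreal (exp (- \<theta> * (LINT x|G. ln (1 + 1))))"
    unfolding S_def by (rule markov_krein_bounded[where K=1]) auto
  also have "exp (- \<theta> * (LINT x|G. ln (1 + 1))) = 2 powr (- \<theta>)"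
    by (simp add: powr_def)
  finally have "has_bochner_integral Q (\<lambda>q. (1 + S q) powr (- \<theta>)) (2 powr (- \<theta>))"
    by (intro has_bochner_integral_nn_integral) auto
  then have int: "integrable Q (\<lambda>q. (1 + S q) powr (- \<theta>) - 2 powr (- \<theta>))"
    and "(LINT q|Q. (1 + S q) powr (- \<theta>) - 2 powr (- \<theta>)) = 0"
    by (auto simp: has_bochner_integral_iff)
  moreover have "AE q in Q. 0 \<le> (1 + S q) powr (- \<theta>) - 2 powr (- \<theta>)"
    using le by eventually_elim (use theta_pos in \<open>auto simp: S_def intro!: powr_mono2' add_pos_nonneg\<close>)
  ultimately have "AE q in Q. (1 + S q) powr (- \<theta>) - 2 powr (- \<theta>) = 0"
    by (subst (asm) integral_nonneg_eq_0_iff_AE) auto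
  then show ?thesis using le
  proof eventually_elim
    fix q assume q: "(1 + S q) powr (- \<theta>) - 2 powr (- \<theta>) = 0" "stick_sum (\<lambda>_. 1) q = ennreal (S q) \<and> S q \<le> 1"
    have "\<not> S q < 1"
    proof
      assume "S q < 1"
      then have "2 powr (- \<theta>) < (1 + S q) powr (- \<theta>)"
        using theta_pos by (intro powr_less_mono2_neg) (auto simp: S_def add_pos_nonneg)
      then show False using q by simp
    qed
    then show "stick_sum (\<lambda>_. 1) q = 1" using q by (simp add: antisym)
  qed
qed

end

subsection \<open>The random variance\<close>

lemma nn_integral_weighted_diracs:
  assumes [measurable]: "h \<in> borel_measurable borel"
  shows "(\<integral>\<^sup>+x. h x \<partial>weighted_diracs (stick_weight v) y) = stick_sum h (v, y)"
proof -
  define D where "D = distr (density (count_space UNIV) (\<lambda>n. ennreal (stick_weight v n))) borel y"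
  have int: "(\<integral>\<^sup>+x. k x \<partial>D) = stick_sum k (v, y)" if [measurable]: "k \<in> borel_measurable borel" for k
    unfolding D_def by (simp add: nn_integral_distr nn_integral_density nn_integral_count_space_nat stick_sum_def)
  have "weighted_diracs (stick_weight v) y = D"
  proof (rule measure_eqI)
    fix A assume "A \<in> sets (weighted_diracs (stick_weight v) y)"
    then have A [measurable]: "A \<in> sets borel" by simp
    have "emeasure D A = (\<integral>\<^sup>+x. indicator A x \<partial>D)"
      by (simp add: D_def)
    also have "\<dots> = stick_sum (indicator A) (v, y)" by (simp add: int)
    finally show "emeasure (weighted_diracs (stick_weight v) y) A = emeasure D A"
      by (simp add: emeasure_weighted_diracs stick_sum_def)
  qed (simp add: D_def)
  with int show ?thesis by simp
qed

lemma lebesgue_integral_weighted_diracs_square: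
  "(LINT x|weighted_diracs (stick_weight v) y. x\<^sup>2) = enn2real (stick_sum (\<lambda>x. ennreal (x\<^sup>2)) (v, y))"
  by (subst integral_eq_nn_integral) (auto simp: nn_integral_weighted_diracs)

text \<open>The value 0 is the default integral of a nonintegrable function. The formula covers this
  case so that \<open>stick_variance\<close> is seen to be measurable on the whole space, not only
  off a null set.\<close>

lemma lebesgue_integral_weighted_diracs_ident:
  "(LINT x|weighted_diracs (stick_weight v) y. x) = (if stick_sum (\<lambda>x. ennreal \<bar>x\<bar>) (v, y) < \<infinity>
     then enn2real (stick_sum (\<lambda>x. ennreal x) (v, y)) - enn2real (stick_sum (\<lambda>x. ennreal (- x)) (v, y)) else 0)"
proof -
  have "integrable (weighted_diracs (stick_weight v) y) (\<lambda>x. x) \<longleftrightarrow> stick_sum (\<lambda>x. ennreal \<bar>x\<bar>) (v, y) < \<infinity>"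
    by (simp add: integrable_iff_bounded nn_integral_weighted_diracs)
  then show ?thesis
    by (auto simp: real_lebesgue_integral_def nn_integral_weighted_diracs not_integrable_integral_eq)
qed

definition stick_variance :: "(nat \<Rightarrow> real) \<times> (nat \<Rightarrow> real) \<Rightarrow> real" where
  "stick_variance q = random_variance (weighted_diracs (stick_weight (fst q)) (snd q))"

definition stick_mean :: "(nat \<Rightarrow> real) \<times> (nat \<Rightarrow> real) \<Rightarrow> real" where
  "stick_mean q = enn2real (stick_sum (\<lambda>x. ennreal x) q)"

definition stick_mean2 :: "(nat \<Rightarrow> real) \<times> (nat \<Rightarrow> real) \<Rightarrow> real" where
  "stick_mean2 q = enn2real (stick_sum (\<lambda>x. ennreal (x\<^sup>2)) q)"

text \<open>The almost sure event on which all computations take place. The last two equations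
  express finite moments, because \<open>stick_mean\<close> and \<open>stick_mean2\<close> are
  \<open>enn2real\<close> values. Nonnegative atoms make \<open>stick_mean\<close> the true mean, as
  \<open>ennreal x\<close> cuts negative \<open>x\<close> off to 0.\<close>

definition regular_sticks :: "(nat \<Rightarrow> real) \<times> (nat \<Rightarrow> real) \<Rightarrow> bool" where
  "regular_sticks q \<longleftrightarrow> (\<forall>n. 0 \<le> snd q n) \<and> stick_sum (\<lambda>_. 1) q = 1 \<and>
     stick_sum (\<lambda>x. ennreal x) q = ennreal (stick_mean q) \<and>
     stick_sum (\<lambda>x. ennreal (x\<^sup>2)) q = ennreal (stick_mean2 q)"

lemma stick_mean_nonneg [simp]: "0 \<le> stick_mean q" "0 \<le> stick_mean2 q"
  by (simp_all add: stick_mean_def stick_mean2_def)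

lemma regular_sticks_weighted_diracs:
  assumes "regular_sticks q"
  defines "P \<equiv> weighted_diracs (stick_weight (fst q)) (snd q)"
  shows "prob_space P" "integrable P (\<lambda>x. x)" "integrable P (\<lambda>x. x\<^sup>2)"
    "(LINT x|P. x) = stick_mean q" "(LINT x|P. x\<^sup>2) = stick_mean2 q"
proof -
  have [simp]: "sets P = sets borel" "space P = UNIV" by (simp_all add: P_def)
  have [measurable_cong]: "sets P = sets borel" by simp
  have nn: "(\<integral>\<^sup>+x. h x \<partial>P) = stick_sum h q" if "h \<in> borel_measurable borel" for h
    using that by (simp add: P_def nn_integral_weighted_diracs)
  show "prob_space P"
    using nn[of "\<lambda>_. 1"] assms(1) by (intro prob_spaceI) (simp add: regular_sticks_def)
  have "indicator {..<0} (snd q n) = (0 :: ennreal)" for n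
    using assms(1) by (auto simp: regular_sticks_def not_less)
  then have "(\<integral>\<^sup>+x. indicator {..<0} x \<partial>P) = 0"
    by (subst nn) (simp_all only: stick_sum_def mult_zero_right suminf_zero, simp)
  then have "{..<0} \<in> null_sets P" by (intro null_setsI) auto
  then have AE: "AE x in P. 0 \<le> x"
    by (auto dest: AE_not_in elim: eventually_mono)
  show "(LINT x|P. x\<^sup>2) = stick_mean2 q"
    by (simp add: P_def lebesgue_integral_weighted_diracs_square stick_mean2_def)
  show "(LINT x|P. x) = stick_mean q"
    using AE by (subst integral_eq_nn_integral) (auto simp: nn stick_mean_def)
  show "integrable P (\<lambda>x. x)" "integrable P (\<lambda>x. x\<^sup>2)"
    using AE assms(1) by (auto intro!: integrableI_nn_integral_finite simp: nn regular_sticks_def)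
qed

lemma stick_variance_regular:
  assumes "regular_sticks q"
  shows "stick_variance q = stick_mean2 q - (stick_mean q)\<^sup>2" and "(stick_mean q)\<^sup>2 \<le> stick_mean2 q"
proof -
  note P = regular_sticks_weighted_diracs[OF assms]
  interpret P: prob_space "weighted_diracs (stick_weight (fst q)) (snd q)" by (rule P(1))
  show "stick_variance q = stick_mean2 q - (stick_mean q)\<^sup>2"
    by (simp add: stick_variance_def random_variance_def P)
  have "P.variance (\<lambda>x. x) = stick_mean2 q - (stick_mean q)\<^sup>2"
    using P.variance_eq[OF P(2,3)] P(4,5) by simp
  moreover have "0 \<le> P.variance (\<lambda>x. x)" by (rule P.variance_positive)
  ultimately show "(stick_mean q)\<^sup>2 \<le> stick_mean2 q" by simp
qed

text \<open>The coefficient \<open>b\<close> may be negative, so the sum cannot be split within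
  \<open>ennreal\<close>. It is read as an integral against the probability measure attached to
  \<open>q\<close>, where linearity is available.\<close>

lemma stick_sum_quadratic:
  assumes "regular_sticks q" and nonneg: "\<And>x. 0 \<le> a + b * x + c * x\<^sup>2"
  shows "stick_sum (\<lambda>x. ennreal (a + b * x + c * x\<^sup>2)) q = ennreal (a + b * stick_mean q + c * stick_mean2 q)"
proof -
  note P = regular_sticks_weighted_diracs[OF assms(1)]
  let ?P = "weighted_diracs (stick_weight (fst q)) (snd q)"
  interpret P: prob_space ?P by (rule P(1))
  have int: "integrable ?P (\<lambda>x. a + b * x + c * x\<^sup>2)" using P by simp
  have "stick_sum (\<lambda>x. ennreal (a + b * x + c * x\<^sup>2)) q = (\<integral>\<^sup>+x. ennreal (a + b * x + c * x\<^sup>2) \<partial>?P)"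
    by (simp add: nn_integral_weighted_diracs)
  also have "\<dots> = ennreal (LINT x|?P. a + b * x + c * x\<^sup>2)"
    using int nonneg by (intro nn_integral_eq_integral) auto
  also have "(LINT x|?P. a + b * x + c * x\<^sup>2) = a + b * stick_mean q + c * stick_mean2 q"
    using P P.prob_space by simp
  finally show ?thesis .
qed

text \<open>Away from the vertex \<open>B\<close> the preimage is covered by the two inverse
  branches of the parabola. These are differentiable and so map null sets to null sets, and the
  vertex is a single point.\<close>

lemma null_sets_quadratic_vimage:
  fixes a b c :: real
  assumes N: "N \<in> null_sets lborel" and a: "a \<noteq> 0"
  shows "{v. a * v\<^sup>2 + b * v + c \<in> N} \<in> null_sets lborel"
proof -
  define B where "B = - b / (2 * a)"
  define A where "A = c - b\<^sup>2 / (4 * a)"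
  have sq: "a * v\<^sup>2 + b * v + c = A + a * (v - B)\<^sup>2" for v
    using a by (simp add: A_def B_def field_simps power2_eq_square)
  \<comment> \<open>A positive radicand excludes the value at the vertex, where the square root is
    not differentiable; the branches then miss only the point \<open>v = B\<close>.\<close>
  define N' where "N' = N \<inter> {y. 0 < (y - A) / a}"
  have "negligible N" using N by (simp add: negligible_iff_null_sets null_sets_completionI)
  then have N': "negligible N'" unfolding N'_def by (rule negligible_subset) auto
  have diff: "(\<lambda>y. B + s * sqrt ((y - A) / a)) differentiable_on N'" for s
  proof (unfold differentiable_on_def, intro ballI)
    fix y assume "y \<in> N'"
    then have "0 < (y - A) / a" by (simp add: N'_def)
    then have "((\<lambda>y. B + s * sqrt ((y - A) / a)) has_real_derivative s * (inverse (sqrt ((y - A) / a)) / 2 * (1 / a))) (at y within N')"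
      using a by (auto intro!: derivative_eq_intros simp: field_simps)
    then show "(\<lambda>y. B + s * sqrt ((y - A) / a)) differentiable at y within N'"
      by (meson has_field_derivative_imp_has_derivative differentiableI)
  qed
  have "negligible ({B} \<union> (\<lambda>y. B + 1 * sqrt ((y - A) / a)) ` N' \<union> (\<lambda>y. B + (- 1) * sqrt ((y - A) / a)) ` N')"
    by (intro negligible_Un negligible_differentiable_image_negligible N' diff) auto
  moreover have "{v. a * v\<^sup>2 + b * v + c \<in> N} \<subseteq> {B} \<union> (\<lambda>y. B + 1 * sqrt ((y - A) / a)) ` N' \<union> (\<lambda>y. B + (- 1) * sqrt ((y - A) / a)) ` N'"
  proof
    fix v assume v: "v \<in> {v. a * v\<^sup>2 + b * v + c \<in> N}"
    let ?y = "a * v\<^sup>2 + b * v + c"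
    have y: "(?y - A) / a = (v - B)\<^sup>2" using a by (simp add: sq)
    consider "v = B" | "v > B" | "v < B" by linarith
    then show "v \<in> {B} \<union> (\<lambda>y. B + 1 * sqrt ((y - A) / a)) ` N' \<union> (\<lambda>y. B + (- 1) * sqrt ((y - A) / a)) ` N'"
    proof cases
      case 2
      then have "v = B + 1 * sqrt ((?y - A) / a)" "?y \<in> N'" using v unfolding N'_def by (simp_all add: y)
      then show ?thesis by blast
    next
      case 3
      then have "v = B + (- 1) * sqrt ((?y - A) / a)" "?y \<in> N'" using v unfolding N'_def by (simp_all add: y)
      then show ?thesis by blast
    qed simp
  qed
  ultimately have "negligible {v. a * v\<^sup>2 + b * v + c \<in> N}" by (rule negligible_subset)
  moreover have "{v. a * v\<^sup>2 + b * v + c \<in> N} \<in> sets lborel"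
  proof -
    have [measurable]: "N \<in> sets borel" using N by auto
    have "{v \<in> space lborel. a * v\<^sup>2 + b * v + c \<in> N} \<in> sets lborel" by measurable
    then show ?thesis by simp
  qed
  ultimately show ?thesis by (simp add: negligible_iff_null_sets null_sets_completion_iff)
qed

context stick_breaking
begin

lemma measurable_stick_variance [measurable]: "stick_variance \<in> borel_measurable Q"
proof -
  have "stick_variance = (\<lambda>q. enn2real (stick_sum (\<lambda>x. ennreal (x\<^sup>2)) q) - (if stick_sum (\<lambda>x. ennreal \<bar>x\<bar>) q < \<infinity>
     then enn2real (stick_sum (\<lambda>x. ennreal x) q) - enn2real (stick_sum (\<lambda>x. ennreal (- x)) q) else 0)\<^sup>2)"
    by (simp add: fun_eq_iff stick_variance_def random_variance_def lebesgue_integral_weighted_diracs_square lebesgue_integral_weighted_diracs_ident)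
  also have "\<dots> \<in> borel_measurable Q" by measurable
  finally show ?thesis .
qed

lemma measurable_stick_mean [measurable]: "stick_mean \<in> borel_measurable Q" "stick_mean2 \<in> borel_measurable Q"
  unfolding stick_mean_def[abs_def] stick_mean2_def[abs_def] by measurable

lemma distr_Q_snd: "distr Q (Pi\<^sub>M UNIV (\<lambda>_. G)) snd = Pi\<^sub>M UNIV (\<lambda>_. G)"
proof (rule measure_eqI)
  fix A assume "A \<in> sets (distr Q (Pi\<^sub>M UNIV (\<lambda>_. G)) snd)"
  then have A: "A \<in> sets (Pi\<^sub>M UNIV (\<lambda>_. G))" by simp
  have "emeasure (distr Q (Pi\<^sub>M UNIV (\<lambda>_. G)) snd) A = emeasure Q (space (Pi\<^sub>M UNIV (\<lambda>_. B)) \<times> A)"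
    using A sets.sets_into_space[OF A]
    by (subst emeasure_distr) (auto simp: Q_def space_pair_measure intro!: arg_cong2[where f=emeasure])
  also have "\<dots> = emeasure (Pi\<^sub>M UNIV (\<lambda>_. G)) A"
    unfolding Q_def using A by (subst SG.P.emeasure_pair_measure_Times) (auto simp: SB.P.emeasure_space_1)
  finally show "emeasure (distr Q (Pi\<^sub>M UNIV (\<lambda>_. G)) snd) A = emeasure (Pi\<^sub>M UNIV (\<lambda>_. G)) A" .
qed simp

lemma AE_Q_snd:
  assumes "AE x in G. R x"
  shows "AE q in Q. \<forall>n. R (snd q n)"
proof -
  have "AE q in Q. R (snd q n)" for n
  proof -
    have "AE y in Pi\<^sub>M (UNIV :: nat set) (\<lambda>_. G). R (y n)"
      by (rule SG.AE_component) (use assms in auto)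
    then have "AE y in distr Q (Pi\<^sub>M UNIV (\<lambda>_. G)) snd. R (y n)"
      by (simp only: distr_Q_snd)
    then show ?thesis by (rule AE_distrD[rotated]) (simp add: Q_def)
  qed
  then show ?thesis by (simp add: AE_all_countable)
qed

end

locale stick_breaking_log = stick_breaking +
  assumes G_nonneg: "AE x in G. 0 \<le> x" and G_log: "integrable G (\<lambda>x. ln (1 + x\<^sup>2))"
begin

text \<open>With the square as \<open>h\<close>, \<open>AE_stick_sum_finite\<close> turns the
  logarithmic condition into a finite second moment. The mean is then finite because x is at most 1
  + x^2 and the total weight is 1.\<close>

lemma AE_regular_sticks: "AE q in Q. regular_sticks q"
  using AE_Q_snd[OF G_nonneg] AE_stick_sum_1 AE_stick_sum_finite[OF _ _ G_log, simplified]
proof eventually_elim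
  fix q assume q: "\<forall>n. 0 \<le> snd q n" "stick_sum (\<lambda>_. 1) q = 1" "stick_sum (\<lambda>x. ennreal (x\<^sup>2)) q \<noteq> \<top>"
  have "stick_sum (\<lambda>x. ennreal x) q \<le> stick_sum (\<lambda>x. 1 + ennreal (x\<^sup>2)) q"
  proof (rule stick_sum_mono)
    fix x :: real
    have "x \<le> 1 + x\<^sup>2" using zero_le_power2[of "x - 1 / 2"] by (simp add: power2_eq_square algebra_simps)
    then show "ennreal x \<le> 1 + ennreal (x\<^sup>2)" by (simp flip: ennreal_1 ennreal_plus add: ennreal_leI)
  qed
  also have "\<dots> = 1 + stick_sum (\<lambda>x. ennreal (x\<^sup>2)) q" using q(2) by (simp add: stick_sum_add)
  also have "\<dots> < \<top>" using q(3) by (simp add: less_top)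
  finally show "regular_sticks q"
    using q by (simp add: regular_sticks_def stick_mean_def stick_mean2_def less_top)
qed

lemma stick_variance_absolutely_continuous:
  assumes atomless: "\<And>x. emeasure G {x} = 0" and N: "N \<in> null_sets lborel"
  shows "AE q in Q. stick_variance q \<notin> N"
proof -
  \<comment> \<open>Being written in terms of the two moments, \<open>D\<close> can be computed
    after a stick has been put in front without knowing that the longer sequence is regular. It
    agrees with the variance on \<open>regular_sticks\<close>.\<close>
  define D where "D q = stick_mean2 q - (stick_mean q)\<^sup>2" for q
  have [measurable]: "D \<in> borel_measurable Q" unfolding D_def by measurable
  have [measurable]: "N \<in> sets borel" using N by auto
  have "(\<integral>\<^sup>+q. indicator N (D q) \<partial>Q) = (\<integral>\<^sup>+x. \<integral>\<^sup>+q. \<integral>\<^sup>+a. indicator N (D (case_nat a (fst q), case_nat x (snd q))) \<partial>B \<partial>Q \<partial>G)"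
    by (rule nn_integral_Q_iterate) simp
  \<comment> \<open>The quadratic in the stick degenerates exactly when the new atom
    \<open>x\<close> equals the mean of the remaining measure. The inner integral is 0 unless this
    happens, and then it is at most 1.\<close>
  also have "\<dots> \<le> (\<integral>\<^sup>+x. \<integral>\<^sup>+q. indicator {stick_mean q} x \<partial>Q \<partial>G)"
  proof (rule nn_integral_mono_AE, use G_nonneg in eventually_elim, rule nn_integral_mono_AE, use AE_regular_sticks in eventually_elim)
    fix x :: real and q assume x: "0 \<le> x" and q: "regular_sticks q"
    let ?m = "stick_mean q" and ?m2 = "stick_mean2 q"
    have D: "D (case_nat a (fst q), case_nat x (snd q)) = - (x - ?m)\<^sup>2 * a\<^sup>2 + (x\<^sup>2 - ?m2 - 2 * ?m * (x - ?m)) * a + (?m2 - ?m\<^sup>2)"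
      if a: "0 < a \<and> a < 1" for a
    proof -
      have "stick_mean (case_nat a (fst q), case_nat x (snd q)) = a * x + (1 - a) * ?m"
        using a x q by (simp add: stick_mean_def[of "(_, _)"] stick_sum_case_nat regular_sticks_def
          ennreal_mult[symmetric] ennreal_plus[symmetric] del: ennreal_plus)
      moreover have "stick_mean2 (case_nat a (fst q), case_nat x (snd q)) = a * x\<^sup>2 + (1 - a) * ?m2"
        using a x q by (simp add: stick_mean2_def[of "(_, _)"] stick_sum_case_nat regular_sticks_def
          ennreal_mult[symmetric] ennreal_plus[symmetric] del: ennreal_plus)
      ultimately show ?thesis unfolding D_def by (simp only:) (simp add: power2_eq_square algebra_simps)
    qed
    show "(\<integral>\<^sup>+a. indicator N (D (case_nat a (fst q), case_nat x (snd q))) \<partial>B) \<le> indicator {?m} x"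
    proof (cases "x = ?m")
      case True
      have "(\<integral>\<^sup>+a. indicator N (D (case_nat a (fst q), case_nat x (snd q))) \<partial>B) \<le> (\<integral>\<^sup>+a. 1 \<partial>B)"
        by (intro nn_integral_mono) (simp add: indicator_def)
      then show ?thesis using True B.emeasure_space_1 by simp
    next
      case False
      have "AE a in lborel. a \<notin> {a. - (x - ?m)\<^sup>2 * a\<^sup>2 + (x\<^sup>2 - ?m2 - 2 * ?m * (x - ?m)) * a + (?m2 - ?m\<^sup>2) \<in> N}"
        using False by (intro AE_not_in null_sets_quadratic_vimage N) simp
      then have "AE a in B. a \<notin> {a. - (x - ?m)\<^sup>2 * a\<^sup>2 + (x\<^sup>2 - ?m2 - 2 * ?m * (x - ?m)) * a + (?m2 - ?m\<^sup>2) \<in> N}"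
        by (rule AE_beta_distributionI)
      then have "AE a in B. indicator N (D (case_nat a (fst q), case_nat x (snd q))) = (0 :: ennreal)"
        using AE_beta_distribution[of 1 \<theta>] by eventually_elim (simp add: D)
      then have "(\<integral>\<^sup>+a. indicator N (D (case_nat a (fst q), case_nat x (snd q))) \<partial>B) = (\<integral>\<^sup>+a. 0 \<partial>B)"
        by (rule nn_integral_cong_AE)
      then show ?thesis by simp
    qed
  qed
  \<comment> \<open>After the swap \<open>x\<close> is integrated with \<open>q\<close> held fixed,
    and the single point \<open>stick_mean q\<close> has \<open>G\<close>-measure 0.\<close>
  also have "\<dots> = (\<integral>\<^sup>+q. \<integral>\<^sup>+x. indicator {stick_mean q} x \<partial>G \<partial>Q)"
  proof -
    interpret QG: pair_sigma_finite Q G ..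
    have "(\<lambda>p. indicator {stick_mean (fst p)} (snd p) :: ennreal) = (\<lambda>p. if snd p = stick_mean (fst p) then 1 else 0)"
      by (auto simp: fun_eq_iff)
    also have "\<dots> \<in> borel_measurable (Q \<Otimes>\<^sub>M G)" by measurable
    finally show ?thesis by (intro QG.Fubini') (simp add: split_beta')
  qed
  also have "\<dots> = 0" by (simp add: atomless)
  finally have "(\<integral>\<^sup>+q. indicator N (D q) \<partial>Q) = 0" by simp
  then have "AE q in Q. indicator N (D q) = (0 :: ennreal)"
    by (subst (asm) nn_integral_0_iff_AE) simp_all
  then show ?thesis using AE_regular_sticks
    by eventually_elim (auto simp: stick_variance_regular(1) D_def indicator_def split: if_splits)
qed

end

subsection \<open>The two transforms of the random variance\<close>

text \<open>Stick-breaking form of the Dirichlet law: the second coordinate is a Beta(1, c) fraction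
  of the length 1 - \<rho> left by the first. The Jacobian 1 - \<rho> raises (1 - \<rho>)^(c - 1) to
  the power c of the Beta(a, c + 1) density, and the constants agree by
  \<open>Gamma (c + 1) = c * Gamma c\<close>.\<close>

lemma nn_integral_dirichlet_distribution2:
  assumes a: "0 < a" and c: "0 < c" and [measurable]: "g \<in> borel_measurable (borel \<Otimes>\<^sub>M borel)"
  shows "(\<integral>\<^sup>+p. g p \<partial>dirichlet_distribution2 a 1 c) =
    (\<integral>\<^sup>+\<rho>. \<integral>\<^sup>+r. g (\<rho>, r * (1 - \<rho>)) \<partial>beta_distribution 1 c \<partial>beta_distribution a (c + 1))"
proof -
  define d where "d = (\<lambda>(x, y). indicator Delta2 (x, y) *
     (Gamma (a + 1 + c) / (Gamma a * Gamma 1 * Gamma c) * x powr (a - 1) * y powr (1 - 1) * (1 - x - y) powr (c - 1)))"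
  have Delta2: "(x, y) \<in> Delta2 \<longleftrightarrow> 0 \<le> x \<and> 0 \<le> y \<and> x + y \<le> 1" for x y by (simp add: Delta2_def)
  have [measurable]: "Delta2 \<in> sets (borel \<Otimes>\<^sub>M borel)"
  proof -
    have "{p \<in> space (borel \<Otimes>\<^sub>M borel). 0 \<le> fst p \<and> 0 \<le> snd p \<and> fst p + snd p \<le> (1::real)} \<in> sets (borel \<Otimes>\<^sub>M borel)"
      by measurable
    also have "{p \<in> space (borel \<Otimes>\<^sub>M borel). 0 \<le> fst p \<and> 0 \<le> snd p \<and> fst p + snd p \<le> (1::real)} = Delta2"
      by (auto simp: Delta2_def space_pair_measure)
    finally show ?thesis .
  qed
  have [measurable]: "d \<in> borel_measurable (borel \<Otimes>\<^sub>M borel)" unfolding d_def by measurable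
  define k1 where "k1 r = c * (1 - r) powr (c - 1)" for r
  define k2 where "k2 \<rho> = Gamma (a + (c + 1)) / (Gamma a * Gamma (c + 1)) * \<rho> powr (a - 1) * (1 - \<rho>) powr (c + 1 - 1)" for \<rho>
  have [measurable]: "k1 \<in> borel_measurable borel" "k2 \<in> borel_measurable borel" unfolding k1_def k2_def by measurable
  have k1: "0 \<le> k1 r" for r using c by (simp add: k1_def)
  have k2: "0 \<le> k2 r" for r using c a by (simp add: k2_def)
  have d_beta: "(1 - \<rho>) * d (\<rho>, r * (1 - \<rho>)) = indicator {0<..<1} r * (k1 r * k2 \<rho>)" if \<rho>: "0 < \<rho>" "\<rho> < 1" for \<rho> r
  proof (cases "r \<in> {0<..<1}")
    case True
    have "r * (1 - \<rho>) \<le> 1 - \<rho>" using True \<rho> by (intro mult_left_le_one_le) auto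
    then have "(\<rho>, r * (1 - \<rho>)) \<in> Delta2"
      unfolding Delta2 using True \<rho> by (intro conjI, simp, simp, linarith)
    moreover have "1 - \<rho> - r * (1 - \<rho>) = (1 - \<rho>) * (1 - r)" by (simp add: algebra_simps)
    ultimately have d: "d (\<rho>, r * (1 - \<rho>)) = Gamma (a + 1 + c) / (Gamma a * Gamma c) * \<rho> powr (a - 1) * ((1 - \<rho>) powr (c - 1) * (1 - r) powr (c - 1))"
      using True \<rho> by (simp add: d_def powr_mult)
    have G: "Gamma (c + 1) = c * Gamma c" using Gamma_plus1[of c] c by (simp add: nonpos_Ints_def)
    have p: "(1 - \<rho>) powr (c + 1 - 1) = (1 - \<rho>) * (1 - \<rho>) powr (c - 1)" using \<rho> by (simp add: powr_mult_base)
    have "a + (c + 1) = a + 1 + c" by simp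
    then have k2: "k2 \<rho> = Gamma (a + 1 + c) / (Gamma a * (c * Gamma c)) * \<rho> powr (a - 1) * ((1 - \<rho>) * (1 - \<rho>) powr (c - 1))"
      unfolding k2_def G p by (simp only:)
    show ?thesis
      unfolding d k2 k1_def using True c by simp
  next
    case False
    \<comment> \<open>At \<open>r = 0\<close> and \<open>r = 1\<close> the point still lies in
      \<open>Delta2\<close>, but the density vanishes there because \<open>0 powr p = 0\<close> for
      every \<open>p\<close>, including \<open>p = 0\<close>.\<close>
    then consider "r < 0" | "r = 0" | "r = 1" | "1 < r" by fastforce
    then have "d (\<rho>, r * (1 - \<rho>)) = 0"
    proof cases
      case 1
      then have "r * (1 - \<rho>) < 0" using \<rho> by (simp add: mult_neg_pos)
      then show ?thesis by (simp add: d_def Delta2)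
    next
      case 4
      then have "1 * (1 - \<rho>) < r * (1 - \<rho>)" using \<rho> by (intro mult_strict_right_mono) auto
      then show ?thesis by (simp add: d_def Delta2)
    qed (simp_all add: d_def)
    then show ?thesis using False by simp
  qed
  have d0: "d (\<rho>, y) = 0" if "\<not> (0 < \<rho> \<and> \<rho> < 1)" for \<rho> y
    using that by (auto simp: d_def Delta2 split: split_indicator)
  have inner: "(\<integral>\<^sup>+y. ennreal (d (\<rho>, y)) * g (\<rho>, y) \<partial>lborel) = ennreal (indicator {0<..<1} \<rho> * k2 \<rho>) * (\<integral>\<^sup>+r. g (\<rho>, r * (1 - \<rho>)) \<partial>beta_distribution 1 c)" for \<rho>
  proof (cases "0 < \<rho> \<and> \<rho> < 1")
    case True
    have "(\<integral>\<^sup>+y. ennreal (d (\<rho>, y)) * g (\<rho>, y) \<partial>lborel) =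
        ennreal (1 - \<rho>) * (\<integral>\<^sup>+r. ennreal (d (\<rho>, r * (1 - \<rho>))) * g (\<rho>, r * (1 - \<rho>)) \<partial>lborel)"
      using True by (subst nn_integral_real_affine[where c="1 - \<rho>" and t=0]) (auto simp: mult.commute)
    also have "\<dots> = (\<integral>\<^sup>+r. ennreal ((1 - \<rho>) * d (\<rho>, r * (1 - \<rho>))) * g (\<rho>, r * (1 - \<rho>)) \<partial>lborel)"
      using True by (subst nn_integral_cmult[symmetric]) (auto simp: ennreal_mult' mult.assoc)
    also have "\<dots> = (\<integral>\<^sup>+r. ennreal (k2 \<rho>) * (ennreal (indicator {0<..<1} r * k1 r) * g (\<rho>, r * (1 - \<rho>))) \<partial>lborel)"
      using True k1 k2
      by (intro nn_integral_cong) (auto simp: d_beta ennreal_mult mult_ac split: split_indicator)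
    also have "\<dots> = ennreal (k2 \<rho>) * (\<integral>\<^sup>+r. g (\<rho>, r * (1 - \<rho>)) \<partial>beta_distribution 1 c)"
      unfolding beta_distribution_1[OF c] k1_def by (subst nn_integral_cmult) (auto simp: nn_integral_density)
    finally show ?thesis using True by simp
  qed (simp add: d0)
  have "(\<integral>\<^sup>+p. g p \<partial>dirichlet_distribution2 a 1 c) = (\<integral>\<^sup>+p. ennreal (d p) * g p \<partial>(lborel \<Otimes>\<^sub>M lborel))"
  proof -
    have "dirichlet_distribution2 a 1 c = density (lborel \<Otimes>\<^sub>M lborel) (\<lambda>p. ennreal (d p))"
      unfolding dirichlet_distribution2_def d_def lborel_prod by (simp add: split_beta')
    then show ?thesis by (simp add: nn_integral_density)
  qed
  also have "\<dots> = (\<integral>\<^sup>+\<rho>. \<integral>\<^sup>+y. ennreal (d (\<rho>, y)) * g (\<rho>, y) \<partial>lborel \<partial>lborel)"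
    by (subst lborel.nn_integral_fst[symmetric]) auto
  also have "\<dots> = (\<integral>\<^sup>+\<rho>. \<integral>\<^sup>+r. g (\<rho>, r * (1 - \<rho>)) \<partial>beta_distribution 1 c \<partial>beta_distribution a (c + 1))"
  proof -
    interpret b: prob_space "beta_distribution 1 c" using c by (intro prob_space_beta_distribution) auto
    show ?thesis
      by (subst nn_integral_beta_distribution)
        (auto intro!: nn_integral_cong simp: inner k2_def split: split_indicator)
  qed
  finally show ?thesis .
qed

lemma Psi0_nonneg [simp]: "0 \<le> Psi0 s \<theta> G u v" and Phi0_nonneg [simp]: "0 \<le> Phi0 s \<theta> G z u v"
  by (simp_all add: Psi0_def Phi0_def)

context stick_breaking_log
begin

text \<open>The quadratic lies between the positive constant \<open>z\<close> and a multiple of 1 +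
  x^2, so its logarithm is dominated by constants plus \<open>ln (1 + x^2)\<close>.\<close>

lemma integrable_ln_quadratic:
  assumes z: "0 < z" and quad: "\<And>x. z \<le> a + b * x + c * x\<^sup>2"
  shows "integrable G (\<lambda>x. ln (a + b * x + c * x\<^sup>2))"
proof (rule Bochner_Integration.integrable_bound)
  let ?C = "\<bar>a\<bar> + \<bar>b\<bar> + \<bar>c\<bar>"
  show "integrable G (\<lambda>x. \<bar>ln z\<bar> + \<bar>ln ?C\<bar> + ln (1 + x\<^sup>2))" using G_log by simp
  show "AE x in G. norm (ln (a + b * x + c * x\<^sup>2)) \<le> norm (\<bar>ln z\<bar> + \<bar>ln ?C\<bar> + ln (1 + x\<^sup>2))"
  proof (rule AE_I2)
    fix x :: real
    have C: "0 < ?C" using quad[of 0] z by auto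
    have W: "0 < 1 + x\<^sup>2" "1 \<le> 1 + x\<^sup>2" by (simp_all add: add_pos_nonneg)
    have "\<bar>x\<bar> \<le> 1 + x\<^sup>2" using zero_le_power2[of "\<bar>x\<bar> - 1 / 2"] by (simp add: power2_eq_square algebra_simps)
    then have "\<bar>b\<bar> * \<bar>x\<bar> \<le> \<bar>b\<bar> * (1 + x\<^sup>2)" by (intro mult_left_mono) auto
    moreover have "\<bar>a\<bar> * 1 \<le> \<bar>a\<bar> * (1 + x\<^sup>2)" by (intro mult_left_mono) auto
    moreover have "c * x\<^sup>2 \<le> \<bar>c\<bar> * (1 + x\<^sup>2)" by (intro mult_mono) auto
    moreover have "b * x \<le> \<bar>b\<bar> * \<bar>x\<bar>" by (metis abs_ge_self abs_mult)
    ultimately have "a + b * x + c * x\<^sup>2 \<le> ?C * (1 + x\<^sup>2)" by (simp only: distrib_right) linarith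
    then have "ln (a + b * x + c * x\<^sup>2) \<le> ln (?C * (1 + x\<^sup>2))"
      using z quad[of x] C W by (subst ln_le_cancel_iff) auto
    also have "\<dots> = ln ?C + ln (1 + x\<^sup>2)" using C W(1) by (rule ln_mult_pos)
    finally have 1: "ln (a + b * x + c * x\<^sup>2) \<le> ln ?C + ln (1 + x\<^sup>2)" .
    have 2: "ln z \<le> ln (a + b * x + c * x\<^sup>2)" using z quad[of x] by (subst ln_le_cancel_iff) auto
    have 3: "0 \<le> ln (1 + x\<^sup>2)" using W by simp
    show "norm (ln (a + b * x + c * x\<^sup>2)) \<le> norm (\<bar>ln z\<bar> + \<bar>ln ?C\<bar> + ln (1 + x\<^sup>2))"
      using 1 2 3 unfolding real_norm_def by linarith
  qed
qed simp

text \<open>\<open>markov_krein\<close> takes a nonnegative function and a positive shift. Moving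
  the lower bound \<open>z\<close> out of the constant term yields both, also when the linear
  coefficient is negative.\<close>

lemma markov_krein_quadratic:
  assumes z: "0 < z" and quad: "\<And>x. z \<le> a + b * x + c * x\<^sup>2"
  shows "(\<integral>\<^sup>+q. ennreal ((a + b * stick_mean q + c * stick_mean2 q) powr (- \<theta>)) \<partial>Q)
    = ennreal (exp (- \<theta> * (LINT x|G. ln (a + b * x + c * x\<^sup>2))))"
proof -
  define h where "h x = (a - z) + b * x + c * x\<^sup>2" for x
  have zh: "z + h x = a + b * x + c * x\<^sup>2" for x by (simp add: h_def)
  have h: "0 \<le> h x" for x using quad[of x] by (simp add: h_def)
  have sum: "stick_sum (\<lambda>x. ennreal (h x)) q = ennreal (a - z + b * stick_mean q + c * stick_mean2 q)" if "regular_sticks q" for q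
    unfolding h_def by (rule stick_sum_quadratic) (use that h in \<open>auto simp: h_def\<close>)
  have fin: "AE q in Q. stick_sum (\<lambda>x. ennreal (h x)) q \<noteq> \<infinity>"
    using AE_regular_sticks by eventually_elim (simp add: sum)
  have "(\<integral>\<^sup>+q. ennreal ((a + b * stick_mean q + c * stick_mean2 q) powr (- \<theta>)) \<partial>Q) =
      (\<integral>\<^sup>+q. ennreal ((z + enn2real (stick_sum (\<lambda>x. ennreal (h x)) q)) powr (- \<theta>)) \<partial>Q)"
  proof (rule nn_integral_cong_AE, use AE_regular_sticks in eventually_elim)
    fix q assume q: "regular_sticks q"
    interpret W: prob_space "weighted_diracs (stick_weight (fst q)) (snd q)" by (rule regular_sticks_weighted_diracs(1)[OF q])
    note P = regular_sticks_weighted_diracs[OF q]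
    \<comment> \<open>Nonnegativity of the value is what allows \<open>enn2real\<close> to undo
      \<open>ennreal\<close> below.\<close>
    have "0 \<le> (LINT x|weighted_diracs (stick_weight (fst q)) (snd q). h x)" using h by simp
    also have "\<dots> = a - z + b * stick_mean q + c * stick_mean2 q"
      unfolding h_def using P W.prob_space by simp
    finally show "ennreal ((a + b * stick_mean q + c * stick_mean2 q) powr (- \<theta>)) =
        ennreal ((z + enn2real (stick_sum (\<lambda>x. ennreal (h x)) q)) powr (- \<theta>))"
      by (simp add: sum[OF q] add.assoc)
  qed
  also have "\<dots> = ennreal (exp (- \<theta> * (LINT x|G. ln (z + h x))))"
    by (rule markov_krein) (use h z fin integrable_ln_quadratic[OF z quad] in \<open>auto simp: zh\<close>, simp add: h_def)
  finally show ?thesis by (simp add: zh)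
qed

lemma set_integral_atLeast_0:
  assumes [measurable]: "f \<in> borel_measurable borel"
  shows "(LINT x:{0..}|G. f x) = (LINT x|G. (f x :: real))"
  unfolding set_lebesgue_integral_def
  by (rule integral_cong_AE) (use G_nonneg in \<open>auto elim!: eventually_mono\<close>)

lemma measurable_Psi0 [measurable]:
  assumes [measurable]: "u \<in> borel_measurable N" "v \<in> borel_measurable N"
  shows "(\<lambda>y. Psi0 s \<theta> G (u y) (v y)) \<in> borel_measurable N"
  unfolding Psi0_def set_lebesgue_integral_def by measurable

lemma measurable_Phi0 [measurable]:
  assumes [measurable]: "u \<in> borel_measurable N" "v \<in> borel_measurable N"
  shows "(\<lambda>y. Phi0 s \<theta> G z (u y) (v y)) \<in> borel_measurable N"
  unfolding Phi0_def set_lebesgue_integral_def by measurable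

text \<open>Completing the square: the quadratic is
  \<open>(1 - \<rho>) + (sqrt \<rho> + s * sqrt (t * (1 - \<rho>)) * x)\<^sup>2\<close>.\<close>

lemma Psi0_quadratic_ge:
  fixes s :: real
  assumes s: "s\<^sup>2 = 1" and t: "0 \<le> t" and \<rho>: "0 < \<rho>" "\<rho> < 1"
  shows "1 - \<rho> \<le> 1 + (s * 2 * sqrt (t * \<rho> * (1 - \<rho>))) * x + t * (1 - \<rho>) * x\<^sup>2"
proof -
  have "(sqrt \<rho> + s * sqrt (t * (1 - \<rho>)) * x)\<^sup>2 = \<rho> + 2 * sqrt \<rho> * (s * sqrt (t * (1 - \<rho>)) * x) + s\<^sup>2 * (t * (1 - \<rho>)) * x\<^sup>2"
    using t \<rho> by (simp add: power2_sum power_mult_distrib)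
  moreover have "sqrt (t * \<rho> * (1 - \<rho>)) = sqrt \<rho> * sqrt (t * (1 - \<rho>))"
    by (simp add: real_sqrt_mult)
  ultimately have "1 + (s * 2 * sqrt (t * \<rho> * (1 - \<rho>))) * x + t * (1 - \<rho>) * x\<^sup>2 = 1 - \<rho> + (sqrt \<rho> + s * sqrt (t * (1 - \<rho>)) * x)\<^sup>2"
    using s by simp
  then show ?thesis by simp
qed

lemma nn_integral_Psi0:
  assumes s: "s\<^sup>2 = 1" and t: "0 \<le> t" and \<rho>: "0 < \<rho>" "\<rho> < 1"
  shows "(\<integral>\<^sup>+q. ennreal ((1 + (s * 2 * sqrt (t * \<rho> * (1 - \<rho>))) * stick_mean q + t * (1 - \<rho>) * stick_mean2 q) powr (- \<theta>)) \<partial>Q)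
    = ennreal (Psi0 s \<theta> G (sqrt (t * \<rho> * (1 - \<rho>))) (t * (1 - \<rho>)))"
proof -
  have "(LINT x:{0..}|G. ln (1 + s * (2 * sqrt (t * \<rho> * (1 - \<rho>)) * x) + t * (1 - \<rho>) * x\<^sup>2)) =
      (LINT x|G. ln (1 + (s * 2 * sqrt (t * \<rho> * (1 - \<rho>))) * x + t * (1 - \<rho>) * x\<^sup>2))"
    by (subst set_integral_atLeast_0) (simp_all add: mult.assoc)
  then show ?thesis
    unfolding Psi0_def using \<rho> Psi0_quadratic_ge[OF assms] by (subst markov_krein_quadratic[of "1 - \<rho>"]) auto
qed

lemma nn_integral_stick_variance_powr:
  assumes \<theta>: "1 / 2 < \<theta>" and t: "0 \<le> t"
  shows "(\<integral>\<^sup>+q. ennreal ((1 + t * stick_variance q) powr (- (\<theta> - 1 / 2))) \<partial>Q) =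
    (\<integral>\<^sup>+\<rho>. ennreal (1 / 2 * (Psi0 1 \<theta> G (sqrt (t * \<rho> * (1 - \<rho>))) (t * (1 - \<rho>)) +
      Psi0 (- 1) \<theta> G (sqrt (t * \<rho> * (1 - \<rho>))) (t * (1 - \<rho>)))) \<partial>beta_distribution (1 / 2) (\<theta> - 1 / 2))"
    (is "_ = ?R")
proof -
  let ?beta = "beta_distribution (1 / 2) (\<theta> - 1 / 2)"
  define k where "k s \<rho> q = (1 + (s * 2 * sqrt (t * \<rho> * (1 - \<rho>))) * stick_mean q + t * (1 - \<rho>) * stick_mean2 q) powr (- \<theta>)" for s \<rho> q
  interpret beta: prob_space ?beta using \<theta> by (intro prob_space_beta_distribution) auto
  interpret bQ: pair_sigma_finite ?beta Q ..
  have [measurable]: "(\<lambda>p. k s (fst p) (snd p)) \<in> borel_measurable (?beta \<Otimes>\<^sub>M Q)" "k s \<rho> \<in> borel_measurable Q" for s \<rho>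
    unfolding k_def by measurable
  have "?R = (\<integral>\<^sup>+\<rho>. \<integral>\<^sup>+q. ennreal (1 / 2 * (k 1 \<rho> q + k (- 1) \<rho> q)) \<partial>Q \<partial>?beta)"
  proof (rule nn_integral_cong_AE, use AE_beta_distribution in eventually_elim)
    fix \<rho> :: real assume \<rho>: "0 < \<rho> \<and> \<rho> < 1"
    have lin: "ennreal (1 / 2 * (u + v)) = ennreal (1 / 2) * (ennreal u + ennreal v)" if "0 \<le> u" "0 \<le> v" for u v :: real
      unfolding ennreal_plus[OF that, symmetric] by (rule ennreal_mult) (use that in auto)
    have "(\<integral>\<^sup>+q. ennreal (1 / 2 * (k 1 \<rho> q + k (- 1) \<rho> q)) \<partial>Q) = (\<integral>\<^sup>+q. ennreal (1 / 2) * (ennreal (k 1 \<rho> q) + ennreal (k (- 1) \<rho> q)) \<partial>Q)"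
      by (intro nn_integral_cong lin) (simp_all add: k_def)
    also have "\<dots> = ennreal (1 / 2) * ((\<integral>\<^sup>+q. ennreal (k 1 \<rho> q) \<partial>Q) + (\<integral>\<^sup>+q. ennreal (k (- 1) \<rho> q) \<partial>Q))"
      by (subst nn_integral_cmult, simp, subst nn_integral_add) simp_all
    also have "\<dots> = ennreal (1 / 2) * (ennreal (Psi0 1 \<theta> G (sqrt (t * \<rho> * (1 - \<rho>))) (t * (1 - \<rho>))) +
        ennreal (Psi0 (- 1) \<theta> G (sqrt (t * \<rho> * (1 - \<rho>))) (t * (1 - \<rho>))))"
      unfolding k_def using \<rho> t by (subst (1 2) nn_integral_Psi0) auto
    also have "\<dots> = ennreal (1 / 2 * (Psi0 1 \<theta> G (sqrt (t * \<rho> * (1 - \<rho>))) (t * (1 - \<rho>)) +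
      Psi0 (- 1) \<theta> G (sqrt (t * \<rho> * (1 - \<rho>))) (t * (1 - \<rho>))))"
      by (intro lin[symmetric]) (simp_all add: Psi0_def)
    finally show "ennreal (1 / 2 * (Psi0 1 \<theta> G (sqrt (t * \<rho> * (1 - \<rho>))) (t * (1 - \<rho>)) +
      Psi0 (- 1) \<theta> G (sqrt (t * \<rho> * (1 - \<rho>))) (t * (1 - \<rho>)))) = (\<integral>\<^sup>+q. ennreal (1 / 2 * (k 1 \<rho> q + k (- 1) \<rho> q)) \<partial>Q)"
      by (rule sym)
  qed
  \<comment> \<open>For fixed \<rho> the Markov--Krein identity produced an expectation over
    \<open>q\<close>; in the other order the average over \<rho> is taken with both moments fixed
    and leaves only the variance.\<close>
  also have "\<dots> = (\<integral>\<^sup>+q. \<integral>\<^sup>+\<rho>. ennreal (1 / 2 * (k 1 \<rho> q + k (- 1) \<rho> q)) \<partial>?beta \<partial>Q)"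
    by (rule bQ.Fubini'[symmetric]) (simp add: split_beta')
  also have "\<dots> = (\<integral>\<^sup>+q. ennreal ((1 + t * stick_variance q) powr (- (\<theta> - 1 / 2))) \<partial>Q)"
  proof (rule nn_integral_cong_AE, use AE_regular_sticks in eventually_elim)
    fix q assume q: "regular_sticks q"
    show "(\<integral>\<^sup>+\<rho>. ennreal (1 / 2 * (k 1 \<rho> q + k (- 1) \<rho> q)) \<partial>?beta) = ennreal ((1 + t * stick_variance q) powr (- (\<theta> - 1 / 2)))"
      using nn_integral_beta_distribution_quadratic[OF \<theta> t stick_variance_regular(2)[OF q]]
      by (simp add: k_def stick_variance_regular(1)[OF q])
  qed
  finally show ?thesis by simp
qed

text \<open>With t = r / z, multiplying the quadratic by \<open>z\<close> turns one integrand into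
  the other. Inside the logarithm this adds \<open>ln z\<close>, which integrates to itself because
  \<open>G\<close> has mass 1 and becomes the factor \<open>z powr \<theta>\<close>.\<close>

lemma Psi0_eq_Phi0:
  assumes s: "s\<^sup>2 = 1" and z: "0 < z" and r: "0 \<le> r" and \<rho>: "0 < \<rho>" "\<rho> < 1"
  shows "Psi0 s \<theta> G (sqrt (r / z * \<rho> * (1 - \<rho>))) (r / z * (1 - \<rho>)) = z powr \<theta> * Phi0 s \<theta> G z \<rho> (r * (1 - \<rho>))"
proof -
  define b where "b = s * 2 * sqrt (r / z * \<rho> * (1 - \<rho>))"
  define k where "k = r / z * (1 - \<rho>)"
  have t: "0 \<le> r / z" using r z by simp
  have ge: "1 - \<rho> \<le> 1 + b * x + k * x\<^sup>2" for x
    unfolding b_def k_def by (rule Psi0_quadratic_ge[OF s t \<rho>])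
  have pos: "0 < 1 + b * x + k * x\<^sup>2" for x using ge[of x] \<rho> by linarith
  have int: "integrable G (\<lambda>x. ln (1 + b * x + k * x\<^sup>2))"
    using \<rho> ge by (intro integrable_ln_quadratic[of "1 - \<rho>"]) auto
  have "sqrt (z * \<rho> * (r * (1 - \<rho>))) = sqrt (z\<^sup>2 * (r / z * \<rho> * (1 - \<rho>)))"
    using z by (simp add: power2_eq_square field_simps)
  also have "\<dots> = z * sqrt (r / z * \<rho> * (1 - \<rho>))"
    using z by (subst real_sqrt_mult) simp
  finally have sq: "sqrt (z * \<rho> * (r * (1 - \<rho>))) = z * sqrt (r / z * \<rho> * (1 - \<rho>))" .
  have arg: "z + s * (2 * sqrt (z * \<rho> * (r * (1 - \<rho>))) * x) + r * (1 - \<rho>) * x\<^sup>2 = z * (1 + b * x + k * x\<^sup>2)" for x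
    unfolding sq b_def k_def using z by (simp add: field_simps)
  have "(LINT x:{0..}|G. ln (z + s * (2 * sqrt (z * \<rho> * (r * (1 - \<rho>))) * x) + r * (1 - \<rho>) * x\<^sup>2)) =
      (LINT x|G. ln z + ln (1 + b * x + k * x\<^sup>2))"
    unfolding arg by (subst set_integral_atLeast_0) (simp_all add: ln_mult_pos[OF z pos])
  also have "\<dots> = ln z + (LINT x|G. ln (1 + b * x + k * x\<^sup>2))" using int by simp
  also have "(LINT x|G. ln (1 + b * x + k * x\<^sup>2)) =
      (LINT x:{0..}|G. ln (1 + s * (2 * sqrt (r / z * \<rho> * (1 - \<rho>)) * x) + r / z * (1 - \<rho>) * x\<^sup>2))"
    unfolding b_def k_def by (subst set_integral_atLeast_0) (simp_all add: mult.assoc)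
  finally show ?thesis
    using z by (simp add: Psi0_def Phi0_def powr_def exp_add[symmetric] algebra_simps)
qed

lemma nn_integral_inverse_stick_variance:
  assumes \<theta>: "3 / 2 < \<theta>" and z: "0 < z"
  shows "(\<integral>\<^sup>+q. ennreal (1 / (z + stick_variance q)) \<partial>Q) =
    ennreal (z powr (\<theta> - 1)) * (\<integral>\<^sup>+p. ennreal ((Phi0 1 \<theta> G z (fst p) (snd p) + Phi0 (- 1) \<theta> G z (fst p) (snd p)) / 2)
      \<partial>dirichlet_distribution2 (1 / 2) 1 (\<theta> - 3 / 2))"
proof -
  define c where "c = \<theta> - 3 / 2"
  \<comment> \<open>The number \<open>c + 1\<close> plays two parts: it is the second Beta parameter
    of the first coordinate of the Dirichlet law, as the first formula requires, and the exponent
    for which the Beta(1, c) integral over \<open>r\<close> is explicit.\<close>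
  have c: "0 < c" and c1: "c + 1 = \<theta> - 1 / 2" using \<theta> by (simp_all add: c_def)
  let ?b1 = "beta_distribution 1 c" and ?b2 = "beta_distribution (1 / 2) (c + 1)"
  define \<Phi> where "\<Phi> \<xi> \<eta> = (Phi0 1 \<theta> G z \<xi> \<eta> + Phi0 (- 1) \<theta> G z \<xi> \<eta>) / 2" for \<xi> \<eta>
  define \<Psi> where "\<Psi> r \<rho> = 1 / 2 * (Psi0 1 \<theta> G (sqrt (r / z * \<rho> * (1 - \<rho>))) (r / z * (1 - \<rho>)) +
      Psi0 (- 1) \<theta> G (sqrt (r / z * \<rho> * (1 - \<rho>))) (r / z * (1 - \<rho>)))" for r \<rho>
  have [measurable]: "(\<lambda>p. \<Phi> (fst p) (snd p)) \<in> borel_measurable (borel \<Otimes>\<^sub>M borel)"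
    "(\<lambda>p. \<Psi> (snd p) (fst p)) \<in> borel_measurable (?b2 \<Otimes>\<^sub>M ?b1)" "\<Psi> r \<in> borel_measurable ?b2" "(\<lambda>r. \<Psi> r \<rho>) \<in> borel_measurable ?b1" for r \<rho>
    unfolding \<Phi>_def \<Psi>_def by measurable
  interpret b1: prob_space ?b1 using c by (intro prob_space_beta_distribution) auto
  interpret b2: prob_space ?b2 using c by (intro prob_space_beta_distribution) auto
  interpret b12: pair_sigma_finite ?b1 Q ..
  interpret b21: pair_sigma_finite ?b2 ?b1 ..
  have "(\<integral>\<^sup>+p. ennreal (\<Phi> (fst p) (snd p)) \<partial>dirichlet_distribution2 (1 / 2) 1 c) =
      (\<integral>\<^sup>+\<rho>. \<integral>\<^sup>+r. ennreal (\<Phi> \<rho> (r * (1 - \<rho>))) \<partial>?b1 \<partial>?b2)"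
    using c by (subst nn_integral_dirichlet_distribution2) simp_all
  also have "\<dots> = (\<integral>\<^sup>+\<rho>. \<integral>\<^sup>+r. ennreal (z powr (- \<theta>)) * ennreal (\<Psi> r \<rho>) \<partial>?b1 \<partial>?b2)"
  proof (rule nn_integral_cong_AE, use AE_beta_distribution in eventually_elim, rule nn_integral_cong_AE, use AE_beta_distribution in eventually_elim)
    fix \<rho> r :: real assume \<rho>: "0 < \<rho> \<and> \<rho> < 1" and r: "0 < r \<and> r < 1"
    have "\<Psi> r \<rho> = z powr \<theta> * \<Phi> \<rho> (r * (1 - \<rho>))"
      unfolding \<Psi>_def \<Phi>_def using \<rho> r z by (subst (1 2) Psi0_eq_Phi0) (auto simp: algebra_simps)
    then have "\<Phi> \<rho> (r * (1 - \<rho>)) = z powr (- \<theta>) * \<Psi> r \<rho>"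
      using z by (simp add: powr_minus)
    then show "ennreal (\<Phi> \<rho> (r * (1 - \<rho>))) = ennreal (z powr (- \<theta>)) * ennreal (\<Psi> r \<rho>)"
      by (simp add: ennreal_mult')
  qed
  also have "\<dots> = ennreal (z powr (- \<theta>)) * (\<integral>\<^sup>+\<rho>. \<integral>\<^sup>+r. ennreal (\<Psi> r \<rho>) \<partial>?b1 \<partial>?b2)"
    by (simp add: nn_integral_cmult)
  also have "(\<integral>\<^sup>+\<rho>. \<integral>\<^sup>+r. ennreal (\<Psi> r \<rho>) \<partial>?b1 \<partial>?b2) = (\<integral>\<^sup>+r. \<integral>\<^sup>+\<rho>. ennreal (\<Psi> r \<rho>) \<partial>?b2 \<partial>?b1)"
    by (rule b21.Fubini'[symmetric]) (simp add: split_beta')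
  also have "\<dots> = (\<integral>\<^sup>+r. \<integral>\<^sup>+q. ennreal ((1 + r / z * stick_variance q) powr (- (\<theta> - 1 / 2))) \<partial>Q \<partial>?b1)"
  proof (rule nn_integral_cong_AE, use AE_beta_distribution in eventually_elim)
    fix r :: real assume "0 < r \<and> r < 1"
    then show "(\<integral>\<^sup>+\<rho>. ennreal (\<Psi> r \<rho>) \<partial>?b2) = (\<integral>\<^sup>+q. ennreal ((1 + r / z * stick_variance q) powr (- (\<theta> - 1 / 2))) \<partial>Q)"
      unfolding \<Psi>_def c1 using \<theta> z by (intro nn_integral_stick_variance_powr[symmetric]) auto
  qed
  also have "\<dots> = (\<integral>\<^sup>+q. \<integral>\<^sup>+r. ennreal ((1 + r / z * stick_variance q) powr (- (\<theta> - 1 / 2))) \<partial>?b1 \<partial>Q)"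
    by (rule b12.Fubini'[symmetric]) simp
  also have "\<dots> = (\<integral>\<^sup>+q. ennreal z * ennreal (1 / (z + stick_variance q)) \<partial>Q)"
  proof (rule nn_integral_cong_AE, use AE_regular_sticks in eventually_elim)
    fix q assume "regular_sticks q"
    then have V: "0 \<le> stick_variance q" using stick_variance_regular[of q] by simp
    \<comment> \<open>As a mixture of the end points 1 + V / z and 1, this has Beta integral 1 / (1
      + V / z) = z / (z + V), the end point 1 contributing the factor 1.\<close>
    have eq: "1 + r / z * stick_variance q = r * (1 + stick_variance q / z) + (1 - r) * 1" for r
      by (simp add: algebra_simps)
    have "(\<integral>\<^sup>+r. ennreal ((1 + r / z * stick_variance q) powr (- (\<theta> - 1 / 2))) \<partial>?b1) =
        ennreal (inverse (1 + stick_variance q / z) * 1 powr (- c))"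
      unfolding eq c1[symmetric] using V z c
      by (intro nn_integral_beta_distribution_1_powr) (auto simp: add_pos_nonneg)
    also have "inverse (1 + stick_variance q / z) * 1 powr (- c) = z * (1 / (z + stick_variance q))"
      using V z by (simp add: field_simps)
    finally show "(\<integral>\<^sup>+r. ennreal ((1 + r / z * stick_variance q) powr (- (\<theta> - 1 / 2))) \<partial>?b1) =
        ennreal z * ennreal (1 / (z + stick_variance q))"
      using V z by (simp add: ennreal_mult[symmetric])
  qed
  also have "\<dots> = ennreal z * (\<integral>\<^sup>+q. ennreal (1 / (z + stick_variance q)) \<partial>Q)"
    by (rule nn_integral_cmult) simp
  finally have "ennreal (z powr (\<theta> - 1)) * (\<integral>\<^sup>+p. ennreal (\<Phi> (fst p) (snd p)) \<partial>dirichlet_distribution2 (1 / 2) 1 c) =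
      ennreal (z powr (\<theta> - 1)) * (ennreal (z powr (- \<theta>)) * (ennreal z * (\<integral>\<^sup>+q. ennreal (1 / (z + stick_variance q)) \<partial>Q)))"
    by simp
  also have "\<dots> = ennreal (z powr (\<theta> - 1) * z powr (- \<theta>) * z) * (\<integral>\<^sup>+q. ennreal (1 / (z + stick_variance q)) \<partial>Q)"
    using z by (simp add: ennreal_mult mult.assoc)
  also have "z powr (\<theta> - 1) * z powr (- \<theta>) * z = 1"
    using z by (simp add: powr_diff powr_minus)
  finally show ?thesis by (simp add: \<Phi>_def c_def)
qed

end

section \<open>Transfer to an arbitrary Dirichlet process and conclusion\<close>

lemma dirichlet_process_obtain_sticks:
  assumes "dirichlet_process M \<theta> G P" and \<theta>: "0 < \<theta>" and G: "prob_space G" "sets G = sets borel"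
  obtains X where "X \<in> measurable M (stick_breaking.Q \<theta> G)" "distr M (stick_breaking.Q \<theta> G) X = stick_breaking.Q \<theta> G"
    "\<And>\<omega>. \<omega> \<in> space M \<Longrightarrow> P \<omega> = weighted_diracs (stick_weight (fst (X \<omega>))) (snd (X \<omega>))"
proof -
  interpret stick_breaking \<theta> G by (rule stick_breaking.intro) fact+
  interpret M: prob_space M using assms(1) by (simp add: dirichlet_process_def)
  have PiM_distr: "distr M (Pi\<^sub>M UNIV (\<lambda>_. borel)) (\<lambda>\<omega> n. W n \<omega>) = Pi\<^sub>M UNIV (\<lambda>n. distr M borel (W n))"
    if W: "M.indep_vars (\<lambda>_. borel) W (UNIV :: nat set)" for W :: "nat \<Rightarrow> 'a \<Rightarrow> real"
  proof -
    have "M.random_variable borel (W n)" for n using W by (simp add: M.indep_vars_def2)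
    from M.indep_vars_iff_distr_eq_PiM[where I=UNIV and M'="\<lambda>_. borel" and X=W, OF _ this] W show ?thesis by (simp add: restrict_UNIV)
  qed
  from assms(1)[unfolded dirichlet_process_def, THEN conjunct2] show thesis
  proof (elim exE conjE)
    fix V \<xi>
    assume V: "M.indep_vars (\<lambda>_. borel) V (UNIV :: nat set)" "\<forall>n. distr M borel (V n) = B"
    and \<xi>: "M.indep_vars (\<lambda>_. borel) \<xi> (UNIV :: nat set)" "\<forall>n. distr M borel (\<xi> n) = G"
    and ind: "M.indep_var (Pi\<^sub>M UNIV (\<lambda>_. borel)) (\<lambda>\<omega> n. V n \<omega>) (Pi\<^sub>M UNIV (\<lambda>_. borel)) (\<lambda>\<omega> n. \<xi> n \<omega>)"
    and P: "\<forall>\<omega>\<in>space M. P \<omega> = weighted_diracs (stick_weight (\<lambda>n. V n \<omega>)) (\<lambda>n. \<xi> n \<omega>)"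
    \<comment> \<open>Independence within each sequence makes its law a product, and independence of
      the two sequences makes the joint law the product of these. Hence \<open>X\<close> has law
      \<open>Q\<close>, and \<open>P\<close> is a function of \<open>X\<close>.\<close>
    define X where "X \<omega> = (\<lambda>n. V n \<omega>, \<lambda>n. \<xi> n \<omega>)" for \<omega>
    let ?S = "Pi\<^sub>M (UNIV :: nat set) (\<lambda>_. borel :: real measure)"
    have rv: "(\<lambda>\<omega> n. V n \<omega>) \<in> measurable M ?S" "(\<lambda>\<omega> n. \<xi> n \<omega>) \<in> measurable M ?S"
      and eq: "distr M ?S (\<lambda>\<omega> n. V n \<omega>) \<Otimes>\<^sub>M distr M ?S (\<lambda>\<omega> n. \<xi> n \<omega>) = distr M (?S \<Otimes>\<^sub>M ?S) X"
      using ind unfolding M.indep_var_distribution_eq X_def by auto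
    have X: "X \<in> measurable M Q"
      unfolding X_def measurable_cong_sets[OF refl sets_Q] using rv by measurable
    moreover have "distr M Q X = distr M (?S \<Otimes>\<^sub>M ?S) X"
      by (intro distr_cong sets_Q) auto
    then have "distr M Q X = Q"
      unfolding eq[symmetric] PiM_distr[OF V(1)] PiM_distr[OF \<xi>(1)] V(2)[rule_format] \<xi>(2)[rule_format] Q_def .
    ultimately show thesis using P by (intro that) (auto simp: X_def)
  qed
qed

theorem corollary1p2:
  fixes \<theta> :: real and G :: "real measure" and M :: "'a measure" and P :: "'a \<Rightarrow> real measure"
  assumes theta: "\<theta> > 1 / 2"
    and G_prob: "prob_space G" "sets G = sets borel"
    and G_nonneg: "emeasure G {0..} = 1"
    and G_atomless: "\<And>x. emeasure G {x} = 0"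
    and G_log: "set_integrable G {0..} (\<lambda>x. ln (1 + x\<^sup>2))"
    and DP: "dirichlet_process M \<theta> G P"
  shows "(\<forall>t\<ge>0.
           (LINT \<omega>|M. (1 / (1 + t * random_variance (P \<omega>))) powr (\<theta> - 1 / 2)) =
           (LINT \<rho>|beta_distribution (1 / 2) (\<theta> - 1 / 2).
              1 / 2 * (Psi0 1 \<theta> G (sqrt (t * \<rho> * (1 - \<rho>))) (t * (1 - \<rho>)) +
                       Psi0 (- 1) \<theta> G (sqrt (t * \<rho> * (1 - \<rho>))) (t * (1 - \<rho>)))))
       \<and> (\<theta> > 3 / 2 \<longrightarrow>
           (\<exists>f. is_pdf M (\<lambda>\<omega>. random_variance (P \<omega>)) f) \<and>
           (\<forall>f. is_pdf M (\<lambda>\<omega>. random_variance (P \<omega>)) f \<longrightarrow>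
             (\<forall>z>0.
               (LINT \<omega>|M. 1 / (z + random_variance (P \<omega>))) = (LINT x:{0..}|lborel. f x / (z + x)) \<and>
               (LINT x:{0..}|lborel. f x / (z + x)) =
                 z powr (\<theta> - 1) *
                 (LINT (\<xi>, \<eta>)|dirichlet_distribution2 (1 / 2) 1 (\<theta> - 3 / 2).
                    (Phi0 1 \<theta> G z \<xi> \<eta> + Phi0 (- 1) \<theta> G z \<xi> \<eta>) / 2))))"
proof -
  have "AE x in G. x \<in> {0..}"
    using prob_space.AE_prob_1[OF G_prob(1), of "{0..}"] G_nonneg by (simp add: measure_def)
  then have nonneg: "AE x in G. 0 \<le> x" by simp
  have "integrable G (\<lambda>x. ln (1 + x\<^sup>2)) \<longleftrightarrow> set_integrable G {0..} (\<lambda>x. ln (1 + x\<^sup>2))"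
    unfolding set_integrable_def
    by (rule integrable_cong_AE) (use nonneg G_prob(2) in \<open>auto simp: measurable_cong_sets[OF G_prob(2) refl] elim!: eventually_mono\<close>)
  with G_log have log: "integrable G (\<lambda>x. ln (1 + x\<^sup>2))" by simp
  interpret stick_breaking_log \<theta> G
    using theta G_prob nonneg log
    by (intro stick_breaking_log.intro stick_breaking.intro stick_breaking_log_axioms.intro) simp_all
  obtain X where X [measurable]: "X \<in> measurable M Q" and distr_X: "distr M Q X = Q"
    and P: "\<And>\<omega>. \<omega> \<in> space M \<Longrightarrow> P \<omega> = weighted_diracs (stick_weight (fst (X \<omega>))) (snd (X \<omega>))"
  proof (rule dirichlet_process_obtain_sticks[OF DP theta_pos G_prob])
    fix X
    assume "X \<in> measurable M Q" "distr M Q X = Q"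
      "\<And>\<omega>. \<omega> \<in> space M \<Longrightarrow> P \<omega> = weighted_diracs (stick_weight (fst (X \<omega>))) (snd (X \<omega>))"
    then show thesis by (rule that)
  qed
  define V where "V \<omega> = random_variance (P \<omega>)" for \<omega>
  have V: "V \<omega> = stick_variance (X \<omega>)" if "\<omega> \<in> space M" for \<omega>
    using P[OF that] by (simp add: V_def stick_variance_def)
  have V_meas [measurable]: "V \<in> borel_measurable M"
    by (subst measurable_cong[OF V]) simp_all
  have nn_V: "(\<integral>\<^sup>+\<omega>. f (V \<omega>) \<partial>M) = (\<integral>\<^sup>+q. f (stick_variance q) \<partial>Q)"
    if [measurable]: "f \<in> borel_measurable borel" for f
  proof -
    have "(\<integral>\<^sup>+q. f (stick_variance q) \<partial>Q) = (\<integral>\<^sup>+q. f (stick_variance q) \<partial>distr M Q X)" by (simp add: distr_X)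
    also have "\<dots> = (\<integral>\<^sup>+\<omega>. f (stick_variance (X \<omega>)) \<partial>M)" by (rule nn_integral_distr) simp_all
    also have "\<dots> = (\<integral>\<^sup>+\<omega>. f (V \<omega>) \<partial>M)" by (intro nn_integral_cong) (simp add: V)
    finally show ?thesis by simp
  qed
  have AE_V: "AE \<omega> in M. R (V \<omega>)" if "AE q in Q. R (stick_variance q)" for R
  proof -
    have "AE q in distr M Q X. R (stick_variance q)" unfolding distr_X by (rule that)
    then have "AE \<omega> in M. R (stick_variance (X \<omega>))" by (rule AE_distrD[OF X])
    then show ?thesis by (rule AE_mp) (auto intro!: AE_I2 simp: V)
  qed
  have "AE q in Q. 0 \<le> stick_variance q"
    using AE_regular_sticks by eventually_elim (simp add: stick_variance_regular)
  then have V_nonneg: "AE \<omega> in M. 0 \<le> V \<omega>" by (rule AE_V)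
  interpret M: prob_space M using DP by (simp add: dirichlet_process_def)
  have part1: "(LINT \<omega>|M. (1 / (1 + t * V \<omega>)) powr (\<theta> - 1 / 2)) =
      (LINT \<rho>|beta_distribution (1 / 2) (\<theta> - 1 / 2).
         1 / 2 * (Psi0 1 \<theta> G (sqrt (t * \<rho> * (1 - \<rho>))) (t * (1 - \<rho>)) +
                  Psi0 (- 1) \<theta> G (sqrt (t * \<rho> * (1 - \<rho>))) (t * (1 - \<rho>))))"
    if t: "0 \<le> t" for t
  proof -
    have "(LINT \<omega>|M. (1 / (1 + t * V \<omega>)) powr (\<theta> - 1 / 2)) =
        enn2real (\<integral>\<^sup>+\<omega>. ennreal ((1 / (1 + t * V \<omega>)) powr (\<theta> - 1 / 2)) \<partial>M)"
      by (rule integral_eq_nn_integral) auto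
    also have "(\<integral>\<^sup>+\<omega>. ennreal ((1 / (1 + t * V \<omega>)) powr (\<theta> - 1 / 2)) \<partial>M) =
        (\<integral>\<^sup>+\<omega>. ennreal ((1 + t * V \<omega>) powr (- (\<theta> - 1 / 2))) \<partial>M)"
    proof (rule nn_integral_cong_AE, use V_nonneg in eventually_elim)
      fix \<omega> assume "0 \<le> V \<omega>"
      then have "0 \<le> 1 + t * V \<omega>" using t by simp
      then have "(1 / (1 + t * V \<omega>)) powr p = (1 + t * V \<omega>) powr (- p)" for p
        by (simp add: powr_minus powr_divide inverse_eq_divide)
      then show "ennreal ((1 / (1 + t * V \<omega>)) powr (\<theta> - 1 / 2)) = ennreal ((1 + t * V \<omega>) powr (- (\<theta> - 1 / 2)))"
        by (simp only:)
    qed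
    also have "\<dots> = (\<integral>\<^sup>+q. ennreal ((1 + t * stick_variance q) powr (- (\<theta> - 1 / 2))) \<partial>Q)"
      by (rule nn_V) simp
    also have "\<dots> = (\<integral>\<^sup>+\<rho>. ennreal (1 / 2 * (Psi0 1 \<theta> G (sqrt (t * \<rho> * (1 - \<rho>))) (t * (1 - \<rho>)) +
        Psi0 (- 1) \<theta> G (sqrt (t * \<rho> * (1 - \<rho>))) (t * (1 - \<rho>)))) \<partial>beta_distribution (1 / 2) (\<theta> - 1 / 2))"
      by (rule nn_integral_stick_variance_powr[OF theta t])
    also have "enn2real \<dots> = (LINT \<rho>|beta_distribution (1 / 2) (\<theta> - 1 / 2).
         1 / 2 * (Psi0 1 \<theta> G (sqrt (t * \<rho> * (1 - \<rho>))) (t * (1 - \<rho>)) +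
                  Psi0 (- 1) \<theta> G (sqrt (t * \<rho> * (1 - \<rho>))) (t * (1 - \<rho>))))"
    proof (rule integral_eq_nn_integral[symmetric], goal_cases)
      case 1
      show ?case by measurable
    next
      case 2
      show ?case by (intro AE_I2 mult_nonneg_nonneg add_nonneg_nonneg Psi0_nonneg) simp
    qed
    finally show ?thesis .
  qed
  have density: "\<exists>f. is_pdf M V f"
  proof -
    have "absolutely_continuous lborel (distr M lborel V)"
      unfolding absolutely_continuous_def
    proof
      fix N :: "real set" assume N: "N \<in> null_sets lborel"
      then have [measurable]: "N \<in> sets borel" by auto
      have "AE \<omega> in M. V \<omega> \<notin> N"
        by (rule AE_V) (rule stick_variance_absolutely_continuous[OF G_atomless N])
      then have "emeasure M {\<omega> \<in> space M. V \<omega> \<in> N} = 0"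
        by (subst AE_iff_measurable[symmetric, where P="\<lambda>\<omega>. V \<omega> \<notin> N"]) auto
      moreover have "V -` N \<inter> space M = {\<omega> \<in> space M. V \<omega> \<in> N}" by auto
      ultimately show "N \<in> null_sets (distr M lborel V)"
        by (intro null_setsI) (simp_all add: emeasure_distr)
    qed
    from sigma_finite_measure.Radon_Nikodym[OF sigma_finite_lborel this] obtain g where
      g [measurable]: "g \<in> borel_measurable lborel" and eq: "density lborel g = distr M lborel V" by auto
    \<comment> \<open>The Radon--Nikodym derivative is \<open>ennreal\<close>-valued, while
      \<open>is_pdf\<close> asks for a real function; total mass 1 confines the value infinity to a
      null set.\<close>
    have "AE x in lborel. g x \<noteq> \<infinity>"
    proof (rule nn_integral_PInf_AE)
      have "(\<integral>\<^sup>+x. g x \<partial>lborel) = emeasure (density lborel g) UNIV" by (simp add: emeasure_density)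
      also have "\<dots> = emeasure M (space M)" unfolding eq by (simp add: emeasure_distr)
      finally show "(\<integral>\<^sup>+x. g x \<partial>lborel) \<noteq> \<infinity>" by (simp add: M.emeasure_space_1)
    qed simp
    then have "density lborel (\<lambda>x. ennreal (enn2real (g x))) = density lborel g"
      by (intro density_cong) (auto elim!: eventually_mono simp: less_top)
    then have "is_pdf M V (\<lambda>x. enn2real (g x))"
      by (simp add: is_pdf_def distributed_def eq)
    then show ?thesis by blast
  qed
  have part2: "(LINT \<omega>|M. 1 / (z + V \<omega>)) = (LINT x:{0..}|lborel. f x / (z + x)) \<and>
      (LINT x:{0..}|lborel. f x / (z + x)) = z powr (\<theta> - 1) *
        (LINT (\<xi>, \<eta>)|dirichlet_distribution2 (1 / 2) 1 (\<theta> - 3 / 2). (Phi0 1 \<theta> G z \<xi> \<eta> + Phi0 (- 1) \<theta> G z \<xi> \<eta>) / 2)"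
    if \<theta>: "3 / 2 < \<theta>" and f: "is_pdf M V f" and z: "0 < z" for f z
  proof
    have f_nonneg: "0 \<le> f x" for x using f by (simp add: is_pdf_def)
    have D: "distributed M lborel V (\<lambda>x. ennreal (f x))" using f by (simp add: is_pdf_def)
    have [measurable]: "f \<in> borel_measurable borel"
      using distributed_real_measurable[OF _ D] f_nonneg by simp
    \<comment> \<open>A density may be positive at negative points, but only on a null set, since
      the variance is almost surely nonnegative. The integral over the half line is therefore the
      integral over the whole line.\<close>
    have "AE x in lborel. 0 < f x \<longrightarrow> 0 \<le> x"
    proof -
      have "AE x in distr M lborel V. 0 \<le> x"
        using V_nonneg by (subst AE_distr_iff) auto
      then have "AE x in density lborel (\<lambda>x. ennreal (f x)). 0 \<le> x"
        unfolding distributed_distr_eq_density[OF D] .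
      then show ?thesis by (subst (asm) AE_density) auto
    qed
    then have f0: "AE x in lborel. indicator {0..} x *\<^sub>R (f x / (z + x)) = f x * (1 / (z + x))"
      by eventually_elim (use f_nonneg in \<open>auto simp: indicator_def order.order_iff_strict\<close>)
    have "(LINT x:{0..}|lborel. f x / (z + x)) = (LINT x|lborel. f x * (1 / (z + x)))"
      unfolding set_lebesgue_integral_def using f0 by (intro integral_cong_AE) auto
    also have "\<dots> = (LINT \<omega>|M. 1 / (z + V \<omega>))"
      by (rule distributed_integral[OF D]) (use f_nonneg in auto)
    finally show 1: "(LINT \<omega>|M. 1 / (z + V \<omega>)) = (LINT x:{0..}|lborel. f x / (z + x))" by simp
    have "(LINT \<omega>|M. 1 / (z + V \<omega>)) = enn2real (\<integral>\<^sup>+\<omega>. ennreal (1 / (z + V \<omega>)) \<partial>M)"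
      using V_nonneg z by (intro integral_eq_nn_integral) (auto elim!: eventually_mono)
    also have "(\<integral>\<^sup>+\<omega>. ennreal (1 / (z + V \<omega>)) \<partial>M) = (\<integral>\<^sup>+q. ennreal (1 / (z + stick_variance q)) \<partial>Q)"
      by (rule nn_V) simp
    also note nn_integral_inverse_stick_variance[OF \<theta> z]
    also have "enn2real (ennreal (z powr (\<theta> - 1)) * (\<integral>\<^sup>+p. ennreal ((Phi0 1 \<theta> G z (fst p) (snd p) + Phi0 (- 1) \<theta> G z (fst p) (snd p)) / 2)
        \<partial>dirichlet_distribution2 (1 / 2) 1 (\<theta> - 3 / 2))) =
        z powr (\<theta> - 1) * (LINT p|dirichlet_distribution2 (1 / 2) 1 (\<theta> - 3 / 2). (Phi0 1 \<theta> G z (fst p) (snd p) + Phi0 (- 1) \<theta> G z (fst p) (snd p)) / 2)"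
    proof -
      have [measurable_cong]: "sets (dirichlet_distribution2 (1 / 2) 1 (\<theta> - 3 / 2)) = sets (borel \<Otimes>\<^sub>M borel)"
        by (simp add: dirichlet_distribution2_def flip: borel_prod)
      show ?thesis
      proof (subst integral_eq_nn_integral, goal_cases)
        case 1
        show ?case by measurable
      next
        case 2
        show ?case by (intro AE_I2 divide_nonneg_nonneg add_nonneg_nonneg Phi0_nonneg) simp
      qed (simp add: enn2real_mult)
    qed
    finally show "(LINT x:{0..}|lborel. f x / (z + x)) = z powr (\<theta> - 1) *
        (LINT (\<xi>, \<eta>)|dirichlet_distribution2 (1 / 2) 1 (\<theta> - 3 / 2). (Phi0 1 \<theta> G z \<xi> \<eta> + Phi0 (- 1) \<theta> G z \<xi> \<eta>) / 2)"
      by (simp add: 1 split_beta')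
  qed
  show ?thesis
    unfolding V_def[symmetric] using part1 density part2 by blast
qed

end
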